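(* Let $p\in(0,\infty)$, $n\ge1$, and let $\psi$ be a surjective $L^p$-isometry on $\mathscr U(M_n(\mathbb C))$. Then there exist a unitary $W\in\mathscr U(M_n(\mathbb C))$ and a $*$-automorphism or a $*$-anti-automorphism $\varphi$ of $M_n(\mathbb C)$ such that $\psi$ is of one of the following forms: (1) $\psi(U)=W\varphi(U)$ for every $U\in\mathscr U(M_n(\mathbb C))$; (2) $\psi(U)=W\varphi(U^* )$ for every $U\in\mathscr U(M_n(\mathbb C))$.
   Context: $\mathscr U(M_n(\mathbb C))$ is the group of $n\times n$ unitary matrices. With $\tau$ the normalized trace on $M_n(\mathbb C)$, $\|A\|_p:=\tau(|A|^p)^{1/p}$ (a quasi-norm when $0<p<1$). A map $\psi:\mathscr U(M_n(\mathbb C))\to\mathscr U(M_n(\mathbb C))$ is an $L^p$-isometry if $\|U-V\|_p=\|\psi(U)-\psi(V)\|_p$ for all $U,V$. A $*$-anti-automorphism is a complex-linear bijection $\varphi$ with $\varphi(A^* )=\varphi(A)^*$ and $\varphi(AB)=\varphi(B)\varphi(A)$. *)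

theory Defs
  imports "HOL-Analysis.Analysis"
begin

definition mat_adj :: "complex^'n^'m \<Rightarrow> complex^'m^'n"
  where "mat_adj A = transpose (map_matrix cnj A)"

definition unitaries :: "(complex^'n^'n) set"
  where "unitaries = {U. U ** mat_adj U = mat 1 \<and> mat_adj U ** U = mat 1}"

definition diag_mat :: "('n \<Rightarrow> complex) \<Rightarrow> complex^'n^'n"
  where "diag_mat d = (\<chi> i j. if i = j then d i else 0)"

text \<open>
  Functional calculus for Hermitian matrices: if \<open>H = V diag(d) V\<^sup>*\<close> with \<open>V\<close> unitary and
  \<open>d\<close> real, then \<open>f(H) = V diag(f \<circ> d) V\<^sup>*\<close>. A diagonalisation exists for Hermitian \<open>H\<close>
  by the spectral theorem; independence of its choice is \<open>mat_fun_unique\<close> below. On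
  non-Hermitian matrices the value is unspecified.
\<close>

definition mat_fun :: "(real \<Rightarrow> real) \<Rightarrow> complex^'n^'n \<Rightarrow> complex^'n^'n"
  where "mat_fun f H = (THE B. \<exists>V\<in>unitaries. \<exists>d :: 'n \<Rightarrow> real.
           H = V ** diag_mat (\<lambda>i. of_real (d i)) ** mat_adj V \<and>
           B = V ** diag_mat (\<lambda>i. of_real (f (d i))) ** mat_adj V)"

definition mat_abs :: "complex^'n^'n \<Rightarrow> complex^'n^'n"
  where "mat_abs A = mat_fun sqrt (mat_adj A ** A)"

text \<open>Only used for \<open>p > 0\<close>, so that the convention \<open>0 powr p = 0\<close> is the right one.\<close>

definition mat_powr :: "complex^'n^'n \<Rightarrow> real \<Rightarrow> complex^'n^'n"
  where "mat_powr H p = mat_fun (\<lambda>t. t powr p) H"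

definition ntrace :: "complex^'n^'n \<Rightarrow> complex"
  where "ntrace A = trace A / of_nat CARD('n)"

text \<open>The trace below is a nonnegative real, as \<open>|A|\<^sup>p\<close> is positive semidefinite.\<close>

definition Lp_norm :: "real \<Rightarrow> complex^'n^'n \<Rightarrow> real"
  where "Lp_norm p A = (Re (ntrace (mat_powr (mat_abs A) p))) powr (1 / p)"

definition Lp_isometry :: "real \<Rightarrow> (complex^'n^'n \<Rightarrow> complex^'n^'n) \<Rightarrow> bool"
  where "Lp_isometry p \<psi> \<longleftrightarrow> \<psi> ` unitaries \<subseteq> unitaries \<and>
           (\<forall>U\<in>unitaries. \<forall>V\<in>unitaries. Lp_norm p (U - V) = Lp_norm p (\<psi> U - \<psi> V))"

definition complex_linear :: "(complex^'n^'n \<Rightarrow> complex^'n^'n) \<Rightarrow> bool"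
  where "complex_linear \<phi> \<longleftrightarrow> (\<forall>A B. \<phi> (A + B) = \<phi> A + \<phi> B) \<and>
           (\<forall>c A. \<phi> (map_matrix ((*) c) A) = map_matrix ((*) c) (\<phi> A))"

definition star_automorphism :: "(complex^'n^'n \<Rightarrow> complex^'n^'n) \<Rightarrow> bool"
  where "star_automorphism \<phi> \<longleftrightarrow> complex_linear \<phi> \<and> bij \<phi> \<and>
           (\<forall>A. \<phi> (mat_adj A) = mat_adj (\<phi> A)) \<and> (\<forall>A B. \<phi> (A ** B) = \<phi> A ** \<phi> B)"

definition star_anti_automorphism :: "(complex^'n^'n \<Rightarrow> complex^'n^'n) \<Rightarrow> bool"
  where "star_anti_automorphism \<phi> \<longleftrightarrow> complex_linear \<phi> \<and> bij \<phi> \<and>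
           (\<forall>A. \<phi> (mat_adj A) = mat_adj (\<phi> A)) \<and> (\<forall>A B. \<phi> (A ** B) = \<phi> B ** \<phi> A)"

lemma diag_mat_mult_left: "(diag_mat d ** A) $ i $ j = d i * A $ i $ j"
  by (simp add: matrix_matrix_mult_def diag_mat_def if_distrib [of "\<lambda>x. x * _"] cong: if_cong)

lemma diag_mat_mult_right: "(A ** diag_mat d) $ i $ j = A $ i $ j * d j"
  by (simp add: matrix_matrix_mult_def diag_mat_def if_distrib [of "\<lambda>x. _ * x"] cong: if_cong)

lemma mat_fun_unique:
  fixes V W :: "complex^'n^'n" and d e :: "'n \<Rightarrow> real"
  assumes V: "V \<in> unitaries" and W: "W \<in> unitaries"
    and eq: "V ** diag_mat (\<lambda>i. of_real (d i)) ** mat_adj V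
           = W ** diag_mat (\<lambda>i. of_real (e i)) ** mat_adj W"
  shows "V ** diag_mat (\<lambda>i. of_real (f (d i))) ** mat_adj V
       = W ** diag_mat (\<lambda>i. of_real (f (e i))) ** mat_adj W"
proof -
  define T where "T = mat_adj W ** V"
  have V1: "V ** mat_adj V = mat 1" "mat_adj V ** V = mat 1"
    and W1: "W ** mat_adj W = mat 1" "mat_adj W ** W = mat 1"
    using V W by (auto simp: unitaries_def)
  let ?D = "\<lambda>d :: 'n \<Rightarrow> real. diag_mat (\<lambda>i. complex_of_real (d i))"
  have "mat_adj W ** (V ** ?D d ** mat_adj V) ** V = mat_adj W ** (W ** ?D e ** mat_adj W) ** V"
    using eq by simp
  hence "T ** ?D d ** (mat_adj V ** V) = (mat_adj W ** W) ** ?D e ** T"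
    unfolding T_def by (simp only: matrix_mul_assoc)
  hence TD: "T ** ?D d = ?D e ** T" by (simp add: V1 W1)
  have "T ** ?D (\<lambda>i. f (d i)) = ?D (\<lambda>i. f (e i)) ** T"
  proof (simp only: vec_eq_iff, intro allI)
    fix i j
    have "(T ** ?D d) $ i $ j = (?D e ** T) $ i $ j" using TD by simp
    hence "T $ i $ j = 0 \<or> d j = e i"
      by (auto simp: diag_mat_mult_left diag_mat_mult_right)
    thus "(T ** ?D (\<lambda>i. f (d i))) $ i $ j = (?D (\<lambda>i. f (e i)) ** T) $ i $ j"
      by (auto simp: diag_mat_mult_left diag_mat_mult_right)
  qed
  hence "W ** (T ** ?D (\<lambda>i. f (d i))) ** mat_adj V = W ** (?D (\<lambda>i. f (e i)) ** T) ** mat_adj V"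
    by simp
  hence "(W ** mat_adj W) ** V ** ?D (\<lambda>i. f (d i)) ** mat_adj V
       = W ** ?D (\<lambda>i. f (e i)) ** mat_adj W ** (V ** mat_adj V)"
    unfolding T_def by (simp only: matrix_mul_assoc)
  thus ?thesis by (simp add: V1 W1)
qed

end

(*
  The p-th power of the distance of U and V is, up to the factor n, the sum of |1 - l|^p over
  the eigenvalues l of U* V. Although it may violate the triangle inequality, the reflection x
  -> b x* b moves every x near b by at least (3/2)^p times the value at (x, b), and the
  Mazur-Ulam argument of Vogt and Vaisala then gives psi (b a* b) = psi b (psi a)* psi b for a
  near b. Normalize psi 1 = 1; then psi commutes with powers of unitaries near 1. A rotation 1 +
  (w - 1) P with P a projection of rank one and w a primitive m-th root of unity close to 1 is
  therefore sent to 1 + (w' - 1) P' with P' of rank one and w' = w or w' = conj w. By continuity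
  and connectedness the same choice is made for every P and every w on the unit circle. The
  distance of the symmetries 1 - 2 P and 1 - 2 Q determines tr (P Q), so Wigner's theorem makes
  P -> P' a conjugation by a unitary, possibly after transposition. Eigenprojections and powers
  extend this to all unitaries.
*)

theory Submission
  imports Defs
begin

subsection \<open>Spectral decomposition of unitary matrices\<close>

text \<open>For \<open>p < 1\<close> distances cannot be chained. Chaining is therefore done in the
  Frobenius norm, which controls and is controlled by the eigenvalue sum uniformly on the group,
  while the Mazur-Ulam step compares displacements by factors only. A reflection expands only near
  its centre \<open>b\<close>, so that step is confined to the points whose distances to
  \<open>a\<close> and to the mirror image of \<open>a\<close> equal that of \<open>b\<close>; this
  set is invariant under the maps involved and lies close to \<open>b\<close>. The distance from the
  identity gives a single sum over the eigenvalues. By itself this does not show that a rotation of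
  rank one goes to a rotation of rank one: the image might have many eigenvalues slightly off 1.
  Finite order excludes this, because nontrivial m-th roots of unity keep a minimal distance from 1,
  and one of them already uses up the whole sum.\<close>

lemma mat_adj_nth [simp]: "mat_adj A $ i $ j = cnj (A $ j $ i)"
  by (simp add: mat_adj_def transpose_def)

lemma mat_adj_mult: "mat_adj (A ** B) = mat_adj B ** mat_adj A"
  by (simp add: vec_eq_iff matrix_matrix_mult_def mult.commute)

lemma mat_adj_adj [simp]: "mat_adj (mat_adj A) = A"
  by (simp add: vec_eq_iff)

lemma mat_adj_one [simp]: "mat_adj (mat 1) = mat 1"
  by (simp add: vec_eq_iff mat_def)

lemma mat_adj_diag [simp]: "mat_adj (diag_mat d) = diag_mat (\<lambda>i. cnj (d i))"
  by (simp add: vec_eq_iff diag_mat_def)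

lemma diag_mat_mult: "diag_mat d ** diag_mat e = diag_mat (\<lambda>i. d i * e i)"
  by (simp add: vec_eq_iff diag_mat_mult_left) (simp add: diag_mat_def)

lemma diag_mat_one [simp]: "diag_mat (\<lambda>i. 1) = mat 1"
  by (simp add: vec_eq_iff diag_mat_def mat_def)

lemma matrix_diff_ldistrib: "A ** (B - C) = A ** B - A ** (C :: complex^'n^'m)"
  by (simp add: vec_eq_iff matrix_matrix_mult_def right_diff_distrib sum_subtractf)

lemma matrix_diff_rdistrib: "(A - B) ** C = A ** C - B ** (C :: complex^'n^'m)"
  by (simp add: vec_eq_iff matrix_matrix_mult_def left_diff_distrib sum_subtractf)

lemma unitaries_iff: "U \<in> unitaries \<longleftrightarrow> mat_adj U ** U = mat 1"
  using matrix_left_right_inverse[of U "mat_adj U"] by (auto simp: unitaries_def)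

lemma unitariesD:
  assumes "U \<in> unitaries"
  shows "U ** mat_adj U = mat 1" "mat_adj U ** U = mat 1"
  using assms by (auto simp: unitaries_def)

lemma unitary_cancel:
  assumes "U \<in> unitaries"
  shows "mat_adj U ** (U ** A) = A" "U ** (mat_adj U ** A) = A"
    "A ** U ** mat_adj U = A" "A ** mat_adj U ** U = A"
  by (metis matrix_mul_assoc matrix_mul_lid matrix_mul_rid unitariesD[OF assms])+

lemma unitaries_mult: "U \<in> unitaries \<Longrightarrow> V \<in> unitaries \<Longrightarrow> U ** V \<in> unitaries"
  unfolding unitaries_iff mat_adj_mult
  by (metis matrix_mul_assoc matrix_mul_lid)

lemma unitaries_adj: "U \<in> unitaries \<Longrightarrow> mat_adj U \<in> unitaries"
  by (simp add: unitaries_def)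

lemma unitaries_one: "mat 1 \<in> unitaries"
  by (simp add: unitaries_iff)

text \<open>With \<open>Q\<close> fixed and \<open>d\<close> varying these matrices form the
  commutative algebra of one orthonormal eigenbasis, in which products and adjoints act pointwise on
  \<open>d\<close>.\<close>

definition spec_mat :: "complex^'n^'n \<Rightarrow> ('n \<Rightarrow> complex) \<Rightarrow> complex^'n^'n"
  where "spec_mat Q d = Q ** diag_mat d ** mat_adj Q"

lemma spec_mat_mult: "Q \<in> unitaries \<Longrightarrow> spec_mat Q d ** spec_mat Q e = spec_mat Q (\<lambda>i. d i * e i)"
  unfolding spec_mat_def diag_mat_mult[symmetric]
  by (simp add: matrix_mul_assoc unitary_cancel)

lemma spec_mat_adj: "mat_adj (spec_mat Q d) = spec_mat Q (\<lambda>i. cnj (d i))"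
  unfolding spec_mat_def by (simp add: mat_adj_mult matrix_mul_assoc)

lemma spec_mat_one: "Q \<in> unitaries \<Longrightarrow> spec_mat Q (\<lambda>i. 1) = mat 1"
  unfolding spec_mat_def by (simp add: unitariesD)

lemma spec_mat_nth: "spec_mat Q d $ i $ j = (\<Sum>k\<in>UNIV. d k * Q $ i $ k * cnj (Q $ j $ k))"
proof -
  have "spec_mat Q d $ i $ j = (\<Sum>k\<in>UNIV. (Q ** diag_mat d) $ i $ k * mat_adj Q $ k $ j)"
    unfolding spec_mat_def matrix_matrix_mult_def by simp
  also have "\<dots> = (\<Sum>k\<in>UNIV. d k * Q $ i $ k * cnj (Q $ j $ k))"
    by (simp add: diag_mat_mult_right mult.commute)
  finally show ?thesis .
qed

lemma spec_mat_diff: "spec_mat Q d - spec_mat Q e = spec_mat Q (\<lambda>i. d i - e i)"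
  by (simp add: vec_eq_iff spec_mat_nth sum_subtractf left_diff_distrib)

lemma spec_mat_inj:
  assumes "Q \<in> unitaries" and "spec_mat Q d = spec_mat Q e"
  shows "d = e"
proof -
  have "mat_adj Q ** spec_mat Q d ** Q = mat_adj Q ** spec_mat Q e ** Q"
    using assms by simp
  hence "diag_mat d = diag_mat e"
    using assms(1) by (simp add: spec_mat_def matrix_mul_assoc unitary_cancel unitariesD)
  hence "diag_mat d $ i $ i = diag_mat e $ i $ i" for i
    by simp
  thus ?thesis
    by (auto simp: diag_mat_def)
qed

lemma spec_mat_in_unitaries:
  assumes "Q \<in> unitaries" "\<And>i. cmod (d i) = 1"
  shows "spec_mat Q d \<in> unitaries"
proof -
  have "cnj (d i) * d i = 1" for i
    using assms(2)[of i] complex_norm_square[of "d i"] by (simp add: mult.commute)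
  thus ?thesis
    using assms(1) by (simp add: unitaries_iff spec_mat_adj spec_mat_mult spec_mat_one)
qed

lemma spec_mat_conjugate: "U ** spec_mat Q d ** mat_adj U = spec_mat (U ** Q) d"
  by (simp add: spec_mat_def mat_adj_mult matrix_mul_assoc)

lemma trace_spec_mat: "Q \<in> unitaries \<Longrightarrow> trace (spec_mat Q d) = (\<Sum>i\<in>UNIV. d i)"
  unfolding spec_mat_def
  by (subst trace_mul_sym, simp add: matrix_mul_assoc unitariesD)
    (simp add: trace_def diag_mat_def)

section \<open>The Hermitian form and eigenvectors of unitary matrices\<close>

definition cip :: "complex^'n \<Rightarrow> complex^'n \<Rightarrow> complex"
  where "cip u v = (\<Sum>i\<in>UNIV. cnj (u $ i) * v $ i)"

lemma Re_cip: "Re (cip u v) = u \<bullet> v"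
  by (simp add: cip_def inner_vec_def inner_complex_def)

lemma cip_cnj: "cnj (cip u v) = cip v u"
  by (simp add: cip_def mult.commute)

lemma cip_scale_right [simp]: "cip u (c *s v) = c * cip u v"
  by (simp add: cip_def sum_distrib_left mult_ac)

lemma cip_scale_left [simp]: "cip (c *s u) v = cnj c * cip u v"
  by (simp add: cip_def sum_distrib_left mult_ac)

lemma cip_add_right: "cip u (v + w) = cip u v + cip u w"
  by (simp add: cip_def sum.distrib distrib_left)

lemma cip_scaleR_right: "cip u (r *\<^sub>R v) = of_real r * cip u v"
  by (simp add: cip_def sum_distrib_left, intro sum.cong, simp_all add: scaleR_conv_of_real[where 'a=complex] mult_ac)

lemma cip_self: "cip u u = of_real ((norm u)\<^sup>2)"
proof -
  have "Im (cip u u) = 0" 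
    by (metis cip_cnj Im_complex_of_real complex_In_mult_cnj_zero complex_cnj_cancel_iff 
        cnj.simps(2) equation_minus_iff_1 neg_equal_zero)
  thus ?thesis
    by (simp add: complex_eq_iff Re_cip dot_square_norm)
qed

lemma cip_zero_right [simp]: "cip u 0 = 0"
  by (simp add: cip_def)

lemma norm_eq_one_if_cip:
  assumes "cip u u = 1"
  shows "norm u = 1"
proof -
  have "(norm u)\<^sup>2 = 1"
    using assms unfolding cip_self of_real_eq_1_iff .
  thus ?thesis
    by (metis abs_norm_cancel abs_square_eq_1)
qed

lemma cip_adj: "cip (mat_adj A *v x) y = cip x (A *v y)"
  unfolding cip_def matrix_vector_mult_def
  by (simp add: sum_distrib_left sum_distrib_right mult_ac) (rule sum.swap)

text \<open>The maximum of the quadratic form on the unit sphere of \<open>S\<close> is attained at an eigenvector.\<close>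

lemma selfadjoint_eigenvector:
  fixes f :: "'a::euclidean_space \<Rightarrow> 'a"
  assumes f: "linear f" and sym: "\<And>x y. f x \<bullet> y = x \<bullet> f y"
    and S: "subspace S" "\<And>x. x \<in> S \<Longrightarrow> f x \<in> S" and u: "u \<in> S" "u \<noteq> 0"
  obtains v c where "v \<in> S" "v \<noteq> 0" "f v = c *\<^sub>R v"
proof -
  let ?K = "S \<inter> sphere 0 1"
  have K: "compact ?K"
    by (intro closed_Int_compact closed_subspace S compact_sphere)
  have "(1 / norm u) *\<^sub>R u \<in> ?K"
    using u S by (auto simp: subspace_scale)
  hence ne: "?K \<noteq> {}" by blast
  have cont: "continuous_on ?K (\<lambda>x. f x \<bullet> x)"
    by (intro continuous_intros linear_continuous_on) (use f linear_conv_bounded_linear in blast)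
  obtain v where v: "v \<in> ?K" and vmax: "\<And>y. y \<in> ?K \<Longrightarrow> f y \<bullet> y \<le> f v \<bullet> v"
    using continuous_attains_sup[OF K ne cont] by blast
  define c where "c = f v \<bullet> v"
  have vv: "v \<bullet> v = 1" using v by (simp add: dot_square_norm)
  have q: "f y \<bullet> y \<le> c * (y \<bullet> y)" if "y \<in> S" for y
  proof (cases "y = 0")
    case True thus ?thesis by simp
  next
    case False
    let ?z = "(1 / norm y) *\<^sub>R y"
    have "?z \<in> ?K" using that S False by (auto simp: subspace_scale)
    from vmax[OF this] have "(f y \<bullet> y) / (norm y * norm y) \<le> c"
      using f by (simp add: c_def linear_cmul)
    thus ?thesis using False by (simp add: divide_simps dot_square_norm power2_eq_square)
  qed
  define w where "w = c *\<^sub>R v - f v"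
  have wS: "w \<in> S" unfolding w_def using v S by (auto intro: subspace_diff subspace_scale)
  define b where "b = c * (w \<bullet> w) - f w \<bullet> w"
  have b: "b \<ge> 0" using q[OF wS] by (simp add: b_def)
  have "w = 0"
  proof (rule ccontr)
    assume "w \<noteq> 0"
    hence ww: "w \<bullet> w > 0" by simp
    \<comment> \<open>At \<open>v + t w\<close> the nonnegative defect of the quadratic form is
      \<open>2 t |w|^2 + t^2 b\<close>, which is negative for small negative \<open>t\<close>. The
      summand 1 keeps the denominator positive when \<open>b = 0\<close>.\<close>
    define t where "t = - (w \<bullet> w) / (b + 1)"
    have "v + t *\<^sub>R w \<in> S" using v wS S by (auto intro: subspace_add subspace_scale)
    from q[OF this] have "0 \<le> c * ((v + t *\<^sub>R w) \<bullet> (v + t *\<^sub>R w)) - f (v + t *\<^sub>R w) \<bullet> (v + t *\<^sub>R w)"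
      by simp
    also have "\<dots> = 2 * t * (c * (v \<bullet> w) - f v \<bullet> w) + t\<^sup>2 * b"
      using f sym[of w v] vv
      by (simp add: linear_add linear_cmul inner_add inner_commute b_def c_def power2_eq_square algebra_simps)
    also have "c * (v \<bullet> w) - f v \<bullet> w = w \<bullet> w"
      by (simp add: w_def inner_diff_left)
    also have "2 * t * (w \<bullet> w) + t\<^sup>2 * b = (w \<bullet> w)\<^sup>2 * (b / (b + 1)\<^sup>2 - 2 / (b + 1))"
      using b by (simp add: t_def power2_eq_square field_simps)
    also have "b / (b + 1)\<^sup>2 - 2 / (b + 1) = - (b + 2) / (b + 1)\<^sup>2"
      using b by (simp add: power2_eq_square divide_simps)
    also have "(w \<bullet> w)\<^sup>2 * (- (b + 2) / (b + 1)\<^sup>2) < 0"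
      using b ww by (intro mult_pos_neg) (auto simp: divide_simps)
    finally show False by simp
  qed
  hence "f v = c *\<^sub>R v" by (simp add: w_def)
  moreover have "v \<in> S" "v \<noteq> 0" using v by auto
  ultimately show ?thesis using that by blast
qed

text \<open>A common eigenvector of the commuting self-adjoint operators \<open>U + U\<^sup>*\<close> and \<open>\<i> (U - U\<^sup>*)\<close>.\<close>

lemma unitary_eigenvector:
  fixes U :: "complex^'n^'n"
  assumes U: "U \<in> unitaries" and S: "subspace S"
    and inv: "\<And>x. x \<in> S \<Longrightarrow> U *v x \<in> S" "\<And>x. x \<in> S \<Longrightarrow> mat_adj U *v x \<in> S"
      "\<And>x. x \<in> S \<Longrightarrow> \<i> *s x \<in> S"
    and u: "u \<in> S" "u \<noteq> 0"
  obtains v c where "v \<in> S" "norm v = 1" "U *v v = c *s v"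
proof -
  define f where "f x = U *v x + mat_adj U *v x" for x
  define g where "g x = \<i> *s (U *v x - mat_adj U *v x)" for x
  have adj: "(U *v x) \<bullet> y = x \<bullet> (mat_adj U *v y)" "(mat_adj U *v x) \<bullet> y = x \<bullet> (U *v y)" for x y
    using cip_adj[of U x y] cip_adj[of "mat_adj U" x y] by (metis Re_cip mat_adj_adj)+
  have iadj: "(\<i> *s x) \<bullet> y = - (x \<bullet> (\<i> *s y))" for x y :: "complex^'n"
    unfolding Re_cip[symmetric] by simp
  have lin: "linear f" "linear g"
    unfolding f_def g_def
    by (rule linearI; simp add: linear_add[OF matrix_vector_mul_linear]
        linear_cmul[OF matrix_vector_mul_linear] vec_eq_iff algebra_simps scaleR_diff_right)+
  have fsym: "f x \<bullet> y = x \<bullet> f y" for x y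
    by (simp add: f_def adj inner_add_left inner_add_right)
  have gsym: "g x \<bullet> y = x \<bullet> g y" for x y
    by (simp add: g_def adj iadj vector_scalar_commute inner_diff_left inner_diff_right algebra_simps
        matrix_vector_mult_diff_distrib vector_ssub_ldistrib)
  have Sf: "f x \<in> S" if "x \<in> S" for x
    using that inv S by (auto simp: f_def intro: subspace_add)
  have Sg: "g x \<in> S" if "x \<in> S" for x
    using that inv S by (auto simp: g_def intro: subspace_diff)
  obtain v a where v: "v \<in> S" "v \<noteq> 0" "f v = a *\<^sub>R v"
    using selfadjoint_eigenvector[OF lin(1) fsym S Sf u] by blast
  define E where "E = {x \<in> S. f x = a *\<^sub>R x}"
  have subE: "subspace E"
    using S lin(1) by (auto simp: subspace_def E_def linear_add linear_cmul linear_0 scaleR_add_right)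
  have comm: "f (g x) = g (f x)" for x
    by (simp add: f_def g_def vector_scalar_commute matrix_vector_mult_diff_distrib
        matrix_vector_right_distrib matrix_vector_mul_assoc unitariesD[OF U])
  have Eg: "g x \<in> E" if "x \<in> E" for x
    using that Sg lin(2) by (auto simp: E_def comm linear_cmul)
  obtain w b where w: "w \<in> E" "w \<noteq> 0" "g w = b *\<^sub>R w"
    using selfadjoint_eigenvector[OF lin(2) gsym subE Eg, of v] v by (auto simp: E_def)
  have fw: "U *v w + mat_adj U *v w = a *\<^sub>R w" and wS: "w \<in> S"
    using w by (auto simp: E_def f_def)
  \<comment> \<open>As operators \<open>2 U = f - i g\<close>, so the eigenvalues \<open>a\<close>
    of \<open>f\<close> and \<open>b\<close> of \<open>g\<close> combine to
    \<open>(a - i b) / 2\<close>.\<close>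
  have Uw: "U *v w = (Complex (a/2) (-b/2)) *s w"
  proof (simp only: vec_eq_iff, intro allI)
    fix i
    have 1: "(U *v w) $ i + (mat_adj U *v w) $ i = of_real a * w $ i"
      using arg_cong[OF fw, of "\<lambda>x. x $ i"] by (simp add: scaleR_conv_of_real[where 'a=complex])
    have 2: "\<i> * ((U *v w) $ i - (mat_adj U *v w) $ i) = of_real b * w $ i"
      using arg_cong[OF w(3), of "\<lambda>x. x $ i"] by (simp add: g_def scaleR_conv_of_real[where 'a=complex] algebra_simps)
    from 2 have 3: "(U *v w) $ i - (mat_adj U *v w) $ i = - \<i> * of_real b * w $ i"
      by (metis (no_types, lifting) i_times_eq_iff mult.assoc mult_minus_left)
    have "2 * (U *v w) $ i = (of_real a - \<i> * of_real b) * w $ i"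
    proof -
      have "2 * (U *v w) $ i = ((U *v w) $ i + (mat_adj U *v w) $ i) + ((U *v w) $ i - (mat_adj U *v w) $ i)"
        by simp
      thus ?thesis unfolding 1 3 by (simp add: algebra_simps)
    qed
    moreover have "of_real a - \<i> * of_real b = 2 * Complex (a/2) (-b/2)"
      by (simp add: complex_eq_iff)
    ultimately show "(U *v w) $ i = (Complex (a/2) (-b/2) *s w) $ i"
      by simp
  qed
  show ?thesis
  proof (rule that)
    show "(1 / norm w) *\<^sub>R w \<in> S" using wS S by (simp add: subspace_scale)
    show "norm ((1 / norm w) *\<^sub>R w) = 1" using w by simp
    show "U *v ((1 / norm w) *\<^sub>R w) = (Complex (a/2) (-b/2)) *s ((1 / norm w) *\<^sub>R w)"
      unfolding linear_cmul[OF matrix_vector_mul_linear] Uw by (simp add: vec_eq_iff)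
  qed
qed

text \<open>A count of real dimensions: the vectors \<open>v i\<close> and \<open>i v i\<close> span
  at most twice \<open>card I\<close> dimensions. Real orthogonality to both of them kills the real
  and the imaginary part of the Hermitian product.\<close>

lemma exists_orthogonal_vector:
  fixes v :: "'n::finite \<Rightarrow> complex^'n"
  assumes "I \<noteq> UNIV"
  obtains x where "x \<noteq> 0" "\<And>i. i \<in> I \<Longrightarrow> cip (v i) x = 0"
proof -
  let ?B = "v ` I \<union> (\<lambda>i. \<i> *s v i) ` I"
  have "card I < CARD('n)"
    using assms by (simp add: psubset_card_mono psubset_eq)
  moreover have "card ?B \<le> card I + card I"
    by (rule order_trans[OF card_Un_le]) (intro add_mono card_image_le; simp)
  ultimately have "dim ?B < DIM(complex^'n)"
    using dim_le_card'[of ?B] by simp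
  then obtain x where x: "x \<noteq> 0" "\<And>y. y \<in> span ?B \<Longrightarrow> orthogonal x y"
    using orthogonal_to_subspace_exists[of ?B] by blast
  have "cip (v i) x = 0" if "i \<in> I" for i
  proof -
    have "v i \<bullet> x = 0" "(\<i> *s v i) \<bullet> x = 0"
      using that x(2) by (auto simp: orthogonal_def inner_commute[of _ x] span_base)
    thus ?thesis
      unfolding Re_cip[symmetric] by (simp add: complex_eq_iff)
  qed
  with x show ?thesis using that by blast
qed

text \<open>The eigenvalue equation for the adjoint is what makes the orthogonal complement of
  eigenvectors invariant under \<open>U\<close>.\<close>

lemma unitary_adj_eigen:
  assumes U: "U \<in> unitaries" and v: "U *v v = c *s v" "norm v = 1"
  shows "cmod c = 1" "mat_adj U *v v = cnj c *s v"
proof -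
  have "mat_adj U *v (U *v v) = v"
    by (simp add: matrix_vector_mul_assoc unitariesD[OF U])
  hence 1: "v = c *s (mat_adj U *v v)"
    by (simp add: v vector_scalar_commute)
  have "cip (U *v v) (U *v v) = cip (mat_adj U *v (U *v v)) v"
    by (simp add: cip_adj)
  also have "\<dots> = cip v v"
    by (simp add: matrix_vector_mul_assoc unitariesD[OF U])
  finally have "c * cnj c = 1"
    by (simp only: v(1) cip_scale_left cip_scale_right) (simp add: cip_self v mult.commute)
  thus c: "cmod c = 1"
    by (metis abs_norm_cancel abs_square_eq_1 complex_norm_square of_real_eq_1_iff)
  have "cnj c *s v = (cnj c * c) *s (mat_adj U *v v)"
    by (subst 1) (simp add: vec_eq_iff mult.assoc)
  thus "mat_adj U *v v = cnj c *s v"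
    using \<open>c * cnj c = 1\<close> by (simp add: mult.commute)
qed

lemma matrix_of_columns_unitary:
  fixes v :: "'n::finite \<Rightarrow> complex^'n"
  assumes "\<And>i j. cip (v i) (v j) = (if i = j then 1 else 0)"
  shows "(\<chi> i j. v j $ i) \<in> unitaries"
  using assms by (simp add: unitaries_iff vec_eq_iff matrix_matrix_mult_def mat_def cip_def)

text \<open>Orthonormal eigenvectors are collected one index at a time. The orthogonal complement of
  those already found is invariant under \<open>U\<close> and its adjoint and nonzero while an index
  is left, so it contains a further eigenvector.\<close>

theorem unitary_spectral:
  fixes U :: "complex^'n^'n"
  assumes U: "U \<in> unitaries"
  obtains Q d where "Q \<in> unitaries" "U = spec_mat Q d" "\<And>i. cmod (d i) = 1"
proof -
  have "\<exists>v c. \<forall>i\<in>I. U *v v i = c i *s v i \<and> (\<forall>j\<in>I. cip (v i) (v j) = (if i = j then 1 else 0))"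
    for I :: "'n set"
    using finite[of I]
  proof (induction I)
    case empty
    show ?case by simp
  next
    case (insert k I)
    then obtain v c where v: "\<And>i. i \<in> I \<Longrightarrow> U *v v i = c i *s v i"
      "\<And>i j. i \<in> I \<Longrightarrow> j \<in> I \<Longrightarrow> cip (v i) (v j) = (if i = j then 1 else 0)"
      by blast
    have nv: "norm (v i) = 1" if "i \<in> I" for i
      by (rule norm_eq_one_if_cip) (simp add: v(2) that)
    have Uv: "mat_adj U *v v i = cnj (c i) *s v i" if "i \<in> I" for i
      using unitary_adj_eigen[OF U v(1)[OF that] nv[OF that]] by simp
    define S where "S = {x. \<forall>i\<in>I. cip (v i) x = 0}"
    have S: "subspace S"
      by (auto simp: subspace_def S_def cip_add_right cip_scaleR_right)
    have "I \<noteq> UNIV" using insert(2) by blast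
    then obtain u where "u \<noteq> 0" "\<And>i. i \<in> I \<Longrightarrow> cip (v i) u = 0"
      using exists_orthogonal_vector[of I v] by metis
    hence u: "u \<in> S" "u \<noteq> 0" by (simp_all add: S_def)
    have inv1: "U *v x \<in> S" if "x \<in> S" for x
      using that cip_adj[of U _ x, symmetric] by (auto simp: S_def Uv)
    have inv2: "mat_adj U *v x \<in> S" if "x \<in> S" for x
      using that cip_adj[of "mat_adj U" _ x, symmetric] by (auto simp: S_def v)
    have inv3: "\<i> *s x \<in> S" if "x \<in> S" for x
      using that by (auto simp: S_def)
    obtain w b where w: "w \<in> S" "norm w = 1" "U *v w = b *s w"
      using unitary_eigenvector[OF U S inv1 inv2 inv3 u] by blast
    have o: "cip (v i) w = 0" "cip w (v i) = 0" if "i \<in> I" for i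
      using w(1) that cip_cnj[of "v i" w] by (auto simp: S_def)
    have "\<forall>i\<in>insert k I. U *v (v(k := w)) i = (c(k := b)) i *s (v(k := w)) i \<and>
        (\<forall>j\<in>insert k I. cip ((v(k := w)) i) ((v(k := w)) j) = (if i = j then 1 else 0))"
      using insert(2) v w o cip_self[of w] by auto
    thus ?case by blast
  qed
  from this[of UNIV] obtain v :: "'n \<Rightarrow> complex^'n" and c where "\<forall>i. U *v v i = c i *s v i \<and> (\<forall>j. cip (v i) (v j) = (if i = j then 1 else 0))"
    by auto
  hence v: "U *v v i = c i *s v i" "cip (v i) (v j) = (if i = j then 1 else 0)" for i j
    by auto
  define Q where "Q = (\<chi> i j. v j $ i)"
  have Q: "Q \<in> unitaries"
    unfolding Q_def by (rule matrix_of_columns_unitary) (rule v(2))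
  have "U ** Q = Q ** diag_mat c"
  proof (simp only: vec_eq_iff, intro allI)
    fix i j
    have "(U ** Q) $ i $ j = (U *v v j) $ i"
      by (simp add: matrix_matrix_mult_def matrix_vector_mult_def Q_def)
    also have "\<dots> = (Q ** diag_mat c) $ i $ j"
      unfolding v(1) diag_mat_mult_right by (simp add: Q_def)
    finally show "(U ** Q) $ i $ j = (Q ** diag_mat c) $ i $ j" .
  qed
  hence "U ** Q ** mat_adj Q = spec_mat Q c"
    by (simp add: spec_mat_def)
  hence "U = spec_mat Q c"
    by (simp add: unitary_cancel[OF Q])
  moreover have "cmod (c i) = 1" for i
  proof (rule unitary_adj_eigen[OF U v(1)])
    show "norm (v i) = 1"
      by (rule norm_eq_one_if_cip) (simp add: v(2))
  qed
  ultimately show ?thesis using that Q by blast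
qed

subsection \<open>The invariant distance\<close>

lemma mat_fun_spec_mat:
  assumes "Q \<in> unitaries"
  shows "mat_fun f (spec_mat Q (\<lambda>i. of_real (d i))) = spec_mat Q (\<lambda>i. of_real (f (d i)))"
  unfolding mat_fun_def
proof (rule the_equality)
  show "\<exists>V\<in>unitaries. \<exists>da. spec_mat Q (\<lambda>i. complex_of_real (d i)) = V ** diag_mat (\<lambda>i. complex_of_real (da i)) ** mat_adj V \<and>
      spec_mat Q (\<lambda>i. complex_of_real (f (d i))) = V ** diag_mat (\<lambda>i. complex_of_real (f (da i))) ** mat_adj V"
    using assms unfolding spec_mat_def by blast
  fix B
  assume "\<exists>V\<in>unitaries. \<exists>da. spec_mat Q (\<lambda>i. complex_of_real (d i)) = V ** diag_mat (\<lambda>i. complex_of_real (da i)) ** mat_adj V \<and>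
      B = V ** diag_mat (\<lambda>i. complex_of_real (f (da i))) ** mat_adj V"
  thus "B = spec_mat Q (\<lambda>i. complex_of_real (f (d i)))"
    unfolding spec_mat_def by (metis (no_types) assms mat_fun_unique)
qed

text \<open>Undoing the root and the normalization of the trace leaves the sum of the p-th powers of
  the singular values.\<close>

definition schatten :: "real \<Rightarrow> complex^'n^'n \<Rightarrow> real"
  where "schatten p A = real CARD('n) * Lp_norm p A powr p"

lemma schatten_cong:
  "mat_adj A ** A = mat_adj B ** B \<Longrightarrow> schatten p A = schatten p B"
  by (simp add: schatten_def Lp_norm_def mat_abs_def)

lemma schatten_spec_mat:
  fixes A Q :: "complex^'n^'n"
  assumes p: "0 < p" and Q: "Q \<in> unitaries"
    and A: "mat_adj A ** A = spec_mat Q (\<lambda>i. of_real (d i))"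
  shows "schatten p A = (\<Sum>i\<in>UNIV. sqrt (d i) powr p)"
proof -
  have "mat_powr (mat_abs A) p = spec_mat Q (\<lambda>i. of_real (sqrt (d i) powr p))"
    unfolding mat_powr_def mat_abs_def A mat_fun_spec_mat[OF Q] ..
  hence "Re (ntrace (mat_powr (mat_abs A) p)) = (\<Sum>i\<in>UNIV. sqrt (d i) powr p) / real CARD('n)"
    by (simp add: ntrace_def trace_spec_mat[OF Q] Re_divide_of_nat)
  moreover have "(\<Sum>i\<in>UNIV. sqrt (d i) powr p) \<ge> 0"
    by (intro sum_nonneg) simp
  ultimately show ?thesis
    using p by (simp add: schatten_def Lp_norm_def powr_powr)
qed

definition schatten_dist :: "real \<Rightarrow> complex^'n^'n \<Rightarrow> complex^'n^'n \<Rightarrow> real"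
  where "schatten_dist p U V = schatten p (U - V)"

text \<open>Since \<open>U - V = U (1 - D)\<close> with \<open>D = mat_adj U ** V\<close>, the
  unitary factor \<open>U\<close> cancels and the singular values of \<open>U - V\<close> are the
  numbers \<open>|1 - d i|\<close>.\<close>

lemma diff_spec_mat:
  assumes "U \<in> unitaries" "Q \<in> unitaries" "mat_adj U ** V = spec_mat Q d"
  shows "mat_adj (U - V) ** (U - V) = spec_mat Q (\<lambda>i. of_real ((cmod (1 - d i))\<^sup>2))"
proof -
  have V: "V = U ** spec_mat Q d"
    unfolding assms(3)[symmetric] by (simp add: unitary_cancel[OF assms(1)])
  have "U - V = U ** spec_mat Q (\<lambda>i. 1 - d i)"
    unfolding V spec_mat_diff[symmetric] spec_mat_one[OF assms(2)] matrix_diff_ldistrib by simp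
  hence "mat_adj (U - V) ** (U - V) = spec_mat Q (\<lambda>i. cnj (1 - d i) * (1 - d i))"
    by (simp add: mat_adj_mult spec_mat_adj spec_mat_mult assms(2) unitary_cancel assms(1) flip: matrix_mul_assoc)
  also have "(\<lambda>i. cnj (1 - d i) * (1 - d i)) = (\<lambda>i. of_real ((cmod (1 - d i))\<^sup>2))"
    unfolding complex_norm_square by (simp only: mult.commute)
  finally show ?thesis .
qed

lemma schatten_dist_spec_mat:
  assumes "0 < p" "U \<in> unitaries" "Q \<in> unitaries" "mat_adj U ** V = spec_mat Q d"
  shows "schatten_dist p U V = (\<Sum>i\<in>UNIV. cmod (1 - d i) powr p)"
  unfolding schatten_dist_def by (simp add: schatten_spec_mat[OF assms(1,3) diff_spec_mat[OF assms(2-4)]])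

lemma norm_eq_trace: "(norm A)\<^sup>2 = Re (trace (mat_adj A ** A))"
proof -
  have "(norm A)\<^sup>2 = (\<Sum>i\<in>UNIV. \<Sum>j\<in>UNIV. (cmod (A $ i $ j))\<^sup>2)"
    by (simp add: norm_vec_def L2_set_def sum_nonneg)
  also have "\<dots> = (\<Sum>j\<in>UNIV. \<Sum>i\<in>UNIV. (cmod (A $ i $ j))\<^sup>2)"
    by (rule sum.swap)
  also have "\<dots> = (\<Sum>j\<in>UNIV. \<Sum>i\<in>UNIV. Re (cnj (A $ i $ j) * A $ i $ j))"
    by (simp only: cmod_power2) (simp add: power2_eq_square)
  also have "\<dots> = Re (trace (mat_adj A ** A))"
    by (simp add: trace_def matrix_matrix_mult_def)
  finally show ?thesis .
qed

lemma norm_diff_spec_mat: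
  assumes "U \<in> unitaries" "Q \<in> unitaries" "mat_adj U ** V = spec_mat Q d"
  shows "(norm (U - V))\<^sup>2 = (\<Sum>i\<in>UNIV. (cmod (1 - d i))\<^sup>2)"
  unfolding norm_eq_trace diff_spec_mat[OF assms] by (simp add: trace_spec_mat[OF assms(2)])

lemma unitary_quotient:
  fixes U V :: "complex^'n^'n"
  assumes "U \<in> unitaries" "V \<in> unitaries"
  obtains Q d where "Q \<in> unitaries" "mat_adj U ** V = spec_mat Q d" "\<And>i. cmod (d i) = 1"
    "V = U ** spec_mat Q d"
proof -
  obtain Q d where *: "Q \<in> unitaries" "mat_adj U ** V = spec_mat Q d" "\<And>i. cmod (d i) = 1"
    using unitary_spectral[of "mat_adj U ** V"] assms unitaries_mult unitaries_adj by metis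
  moreover have "V = U ** spec_mat Q d"
    unfolding *(2)[symmetric] by (simp add: unitary_cancel assms)
  ultimately show ?thesis using that by blast
qed

lemma schatten_dist_nonneg: "0 \<le> schatten_dist p U V"
  by (simp add: schatten_dist_def schatten_def)

lemma schatten_dist_commute: "schatten_dist p U V = schatten_dist p V U"
proof -
  have "mat_adj (U - V) ** (U - V) = mat_adj (V - U) ** (V - U)"
    by (simp add: vec_eq_iff matrix_matrix_mult_def algebra_simps)
  thus ?thesis unfolding schatten_dist_def by (rule schatten_cong)
qed

lemma schatten_dist_mult_left: "W \<in> unitaries \<Longrightarrow> schatten_dist p (W ** U) (W ** V) = schatten_dist p U V"
  unfolding schatten_dist_def matrix_diff_ldistrib[symmetric]
  by (rule schatten_cong) (simp add: mat_adj_mult unitary_cancel flip: matrix_mul_assoc)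

text \<open>Right translation does not fix the square of the absolute value of \<open>U - V\<close>
  but conjugates it, so the comparison is made through eigenvalues.\<close>

lemma schatten_dist_mult_right:
  assumes "0 < p" "W \<in> unitaries" "U \<in> unitaries" "V \<in> unitaries"
  shows "schatten_dist p (U ** W) (V ** W) = schatten_dist p U V"
proof -
  obtain Q d where Q: "Q \<in> unitaries" "mat_adj U ** V = spec_mat Q d"
    using unitary_quotient[OF assms(3,4)] by metis
  have "mat_adj (U ** W) ** (V ** W) = mat_adj W ** (mat_adj U ** V) ** W"
    by (simp add: mat_adj_mult matrix_mul_assoc)
  also have "\<dots> = spec_mat (mat_adj W ** Q) d"
    using spec_mat_conjugate[of "mat_adj W" Q d] Q(2) by simp
  finally have "schatten_dist p (U ** W) (V ** W) = (\<Sum>i\<in>UNIV. cmod (1 - d i) powr p)"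
    by (rule schatten_dist_spec_mat[rotated 3]) (use assms Q in \<open>auto intro: unitaries_mult unitaries_adj\<close>)
  thus ?thesis
    using schatten_dist_spec_mat[OF assms(1,3) Q] by simp
qed

text \<open>If \<open>V = U D\<close>, the quotient of the adjoints is the conjugate by
  \<open>U\<close> of the adjoint of \<open>D\<close>; its eigenvalues are complex conjugates and
  keep their distance from 1.\<close>

lemma schatten_dist_adj:
  assumes "0 < p" "U \<in> unitaries" "V \<in> unitaries"
  shows "schatten_dist p (mat_adj U) (mat_adj V) = schatten_dist p U V"
proof -
  obtain Q d where Q: "Q \<in> unitaries" "mat_adj U ** V = spec_mat Q d" "V = U ** spec_mat Q d"
    using unitary_quotient[OF assms(2,3)] by metis
  have "mat_adj (mat_adj U) ** mat_adj V = spec_mat (U ** Q) (\<lambda>i. cnj (d i))"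
    by (simp add: Q(3) mat_adj_mult spec_mat_adj matrix_mul_assoc spec_mat_conjugate[symmetric])
  hence "schatten_dist p (mat_adj U) (mat_adj V) = (\<Sum>i\<in>UNIV. cmod (1 - cnj (d i)) powr p)"
    by (rule schatten_dist_spec_mat[rotated 3]) (use assms Q in \<open>auto intro: unitaries_mult unitaries_adj\<close>)
  moreover have "cmod (1 - cnj z) = cmod (1 - z)" for z
    by (metis complex_cnj_diff complex_cnj_one complex_mod_cnj)
  ultimately show ?thesis
    using schatten_dist_spec_mat[OF assms(1,2) Q(1,2)] by simp
qed

lemma schatten_dist_le:
  fixes U V :: "complex^'n^'n"
  assumes "0 < p" "U \<in> unitaries" "V \<in> unitaries"
  shows "schatten_dist p U V \<le> real CARD('n) * 2 powr p"
proof -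
  obtain Q d where Q: "Q \<in> unitaries" "mat_adj U ** V = spec_mat Q d" "\<And>i. cmod (d i) = 1"
    using unitary_quotient[OF assms(2,3)] by metis
  have "cmod (1 - d i) \<le> 2" for i
    using norm_triangle_ineq4[of 1 "d i"] Q(3)[of i] by simp
  hence "(\<Sum>i\<in>UNIV. cmod (1 - d i) powr p) \<le> (\<Sum>i::'n\<in>UNIV. 2 powr p)"
    using assms(1) by (intro sum_mono powr_mono2) auto
  thus ?thesis
    using schatten_dist_spec_mat[OF assms(1,2) Q(1,2)] by simp
qed

text \<open>Together with \<open>schatten_dist_small_if_norm_small\<close> this is uniform
  equivalence with the Frobenius norm. It yields continuity of the isometry and stands in for the
  triangle inequality.\<close>

lemma norm_small_if_dist_small:
  assumes p: "0 < p" and "0 < (e::real)"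
  obtains \<delta> where "0 < \<delta>"
    "\<And>U V :: complex^'n^'n. U \<in> unitaries \<Longrightarrow> V \<in> unitaries \<Longrightarrow> schatten_dist p U V < \<delta> \<Longrightarrow> norm (U - V) < e"
proof
  let ?n = "real CARD('n)"
  \<comment> \<open>A sum below this value forces every \<open>|1 - d i|\<close> below
    \<open>e / n\<close>, hence the sum of the squares below \<open>e^2 / n\<close>.\<close>
  let ?\<delta> = "(e / ?n) powr p"
  have n: "?n \<ge> 1" using zero_less_card_finite[where 'a='n] by linarith
  show "0 < ?\<delta>" using assms n by simp
  fix U V :: "complex^'n^'n"
  assume U: "U \<in> unitaries" and V: "V \<in> unitaries" and less: "schatten_dist p U V < ?\<delta>"
  obtain Q d where Q: "Q \<in> unitaries" "mat_adj U ** V = spec_mat Q d"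
    using unitary_quotient[OF U V] by metis
  have "cmod (1 - d i) < e / ?n" for i
  proof (rule ccontr)
    assume "\<not> cmod (1 - d i) < e / ?n"
    hence "?\<delta> \<le> cmod (1 - d i) powr p"
      using assms n by (intro powr_mono2) auto
    also have "\<dots> \<le> schatten_dist p U V"
      unfolding schatten_dist_spec_mat[OF p U Q] by (rule member_le_sum) auto
    finally show False using less by simp
  qed
  hence "(\<Sum>i\<in>UNIV. (cmod (1 - d i))\<^sup>2) < (\<Sum>i::'n\<in>UNIV. (e / ?n)\<^sup>2)"
    by (intro sum_strict_mono power_strict_mono) auto
  also have "\<dots> = e\<^sup>2 / ?n"
    using n by (simp add: power2_eq_square)
  also have "\<dots> \<le> e\<^sup>2"
    using n by (simp add: divide_le_eq mult_le_cancel_left1)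
  finally have "(norm (U - V))\<^sup>2 < e\<^sup>2"
    by (simp add: norm_diff_spec_mat[OF U Q])
  thus "norm (U - V) < e"
    using assms power_less_imp_less_base[of "norm (U - V)" 2 e] by simp
qed

lemma eigenvalue_le_norm:
  assumes "U \<in> unitaries" "Q \<in> unitaries" "mat_adj U ** V = spec_mat Q d"
  shows "cmod (1 - d i) \<le> norm (U - V)"
proof -
  have "(cmod (1 - d i))\<^sup>2 \<le> (\<Sum>i\<in>UNIV. (cmod (1 - d i))\<^sup>2)"
    by (rule member_le_sum) auto
  thus ?thesis
    unfolding norm_diff_spec_mat[OF assms, symmetric] by (rule power2_le_imp_le) simp
qed

lemma schatten_dist_small_if_norm_small:
  assumes p: "0 < p" and "0 < (e::real)"
  obtains \<delta> where "0 < \<delta>"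
    "\<And>U V :: complex^'n^'n. U \<in> unitaries \<Longrightarrow> V \<in> unitaries \<Longrightarrow> norm (U - V) < \<delta> \<Longrightarrow> schatten_dist p U V < e"
proof
  let ?n = "real CARD('n)"
  let ?\<delta> = "(e / ?n) powr (1 / p)"
  have n: "?n \<ge> 1" using zero_less_card_finite[where 'a='n] by linarith
  show "0 < ?\<delta>" using assms n by simp
  fix U V :: "complex^'n^'n"
  assume U: "U \<in> unitaries" and V: "V \<in> unitaries" and less: "norm (U - V) < ?\<delta>"
  obtain Q d where Q: "Q \<in> unitaries" "mat_adj U ** V = spec_mat Q d"
    using unitary_quotient[OF U V] by metis
  have "cmod (1 - d i) powr p < ?\<delta> powr p" for i
    using eigenvalue_le_norm[OF U Q, of i] less p by (intro powr_less_mono2) auto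
  hence "schatten_dist p U V < (\<Sum>i::'n\<in>UNIV. ?\<delta> powr p)"
    unfolding schatten_dist_spec_mat[OF p U Q] by (intro sum_strict_mono) auto
  also have "\<dots> = e"
    using assms n by (simp add: powr_powr)
  finally show "schatten_dist p U V < e" .
qed

lemma schatten_dist_eq_0:
  fixes U V :: "complex^'n^'n"
  assumes "0 < p" "U \<in> unitaries" "V \<in> unitaries" "schatten_dist p U V = 0"
  shows "U = V"
proof -
  obtain Q d where Q: "Q \<in> unitaries" "mat_adj U ** V = spec_mat Q d" "V = U ** spec_mat Q d"
    using unitary_quotient[OF assms(2,3)] by metis
  have "\<forall>i\<in>UNIV. cmod (1 - d i) powr p = 0"
    using assms(4) unfolding schatten_dist_spec_mat[OF assms(1,2) Q(1,2)]
    by (subst (asm) sum_nonneg_eq_0_iff) auto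
  hence "d = (\<lambda>i. 1)" by auto
  thus ?thesis using Q by (simp add: spec_mat_one)
qed

text \<open>Reflecting \<open>x\<close> at \<open>b\<close> squares the quotient of \<open>x\<close>
  and \<open>b\<close>, as a point reflection of a vector space doubles the difference
  \<open>b - x\<close>.\<close>

lemma reflection_quotient:
  assumes "x \<in> unitaries" "Q \<in> unitaries" "mat_adj x ** b = spec_mat Q d"
  shows "mat_adj x ** (b ** mat_adj x ** b) = spec_mat Q (\<lambda>i. d i * d i)"
proof -
  have "mat_adj x ** (b ** mat_adj x ** b) = (mat_adj x ** b) ** (mat_adj x ** b)"
    by (simp add: matrix_mul_assoc)
  thus ?thesis using assms by (simp add: spec_mat_mult)
qed

lemma cmod_one_minus_square: "cmod (1 - z * z) = cmod (1 + z) * cmod (1 - z)"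
  unfolding norm_mult[symmetric] by (simp add: algebra_simps)

lemma schatten_dist_reflection_le:
  fixes x b :: "complex^'n^'n"
  assumes "0 < p" "x \<in> unitaries" "b \<in> unitaries"
  shows "schatten_dist p x (b ** mat_adj x ** b) \<le> 2 powr p * schatten_dist p x b"
proof -
  obtain Q d where Q: "Q \<in> unitaries" "mat_adj x ** b = spec_mat Q d" "\<And>i. cmod (d i) = 1"
    using unitary_quotient[OF assms(2,3)] by metis
  have 1: "cmod (1 + d i) \<le> 2" for i
    using norm_triangle_ineq[of 1 "d i"] Q(3)[of i] by simp
  have "cmod (1 - d i * d i) powr p \<le> 2 powr p * cmod (1 - d i) powr p" for i
    unfolding cmod_one_minus_square using assms(1) 1[of i]
    by (subst powr_mult) (auto intro!: mult_right_mono powr_mono2)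
  thus ?thesis
    using schatten_dist_spec_mat[OF assms(1,2) Q(1) reflection_quotient[OF assms(2) Q(1,2)]]
      schatten_dist_spec_mat[OF assms(1,2) Q(1,2)]
    by (simp add: sum_distrib_left sum_mono)
qed

text \<open>Squaring an eigenvalue \<open>z\<close> multiplies \<open>|1 - z|\<close> by
  \<open>|1 + z|\<close>, which is at least \<open>2 - |1 - z|\<close>. Within Frobenius distance
  1/2 this is at least 3/2 for every eigenvalue.\<close>

lemma schatten_dist_reflection_ge:
  fixes x b :: "complex^'n^'n"
  assumes "0 < p" "x \<in> unitaries" "b \<in> unitaries" "norm (x - b) \<le> 1/2"
  shows "(3/2) powr p * schatten_dist p x b \<le> schatten_dist p x (b ** mat_adj x ** b)"
proof -
  obtain Q d where Q: "Q \<in> unitaries" "mat_adj x ** b = spec_mat Q d" "\<And>i. cmod (d i) = 1"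
    using unitary_quotient[OF assms(2,3)] by metis
  have 1: "cmod (1 + d i) \<ge> 3/2" for i
  proof -
    have "2 \<le> cmod (1 + d i) + cmod (1 - d i)"
      using norm_triangle_ineq[of "1 + d i" "1 - d i"] by simp
    thus ?thesis
      using eigenvalue_le_norm[OF assms(2) Q(1,2), of i] assms(4) by simp
  qed
  have "(3/2) powr p * cmod (1 - d i) powr p \<le> cmod (1 - d i * d i) powr p" for i
    unfolding cmod_one_minus_square using assms(1) 1[of i]
    by (subst powr_mult) (auto intro!: mult_right_mono powr_mono2)
  thus ?thesis
    using schatten_dist_spec_mat[OF assms(1,2) Q(1) reflection_quotient[OF assms(2) Q(1,2)]]
      schatten_dist_spec_mat[OF assms(1,2) Q(1,2)]
    by (simp add: sum_distrib_left sum_mono)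
qed

text \<open>The principal square root has nonnegative real part; consequently taking it never
  increases the distance from 1.\<close>

lemma cmod_one_plus_csqrt: "1 \<le> cmod (1 + csqrt z)"
  using complex_Re_le_cmod[of "1 + csqrt z"] Re_csqrt[of z] by (simp del: csqrt.simps)

lemma cmod_one_minus_csqrt: "cmod (1 - csqrt z) \<le> cmod (1 - z)"
proof -
  have "cmod (1 - z) = cmod (1 + csqrt z) * cmod (1 - csqrt z)"
    using cmod_one_minus_square[of "csqrt z"] by (simp flip: power2_eq_square)
  thus ?thesis
    using mult_right_mono[OF cmod_one_plus_csqrt[of z], of "cmod (1 - csqrt z)"] by simp
qed

text \<open>The witness is \<open>a\<close> times the principal square root of the quotient of
  \<open>a\<close> and \<open>c\<close>. Its distance bound locates the midpoint of two image points
  without a triangle inequality.\<close>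

lemma unitary_midpoint:
  fixes a c :: "complex^'n^'n"
  assumes "0 < p" "a \<in> unitaries" "c \<in> unitaries"
  obtains b where "b \<in> unitaries" "b ** mat_adj a ** b = c" "schatten_dist p a b \<le> schatten_dist p a c"
proof -
  obtain Q d where Q: "Q \<in> unitaries" "mat_adj a ** c = spec_mat Q d" "\<And>i. cmod (d i) = 1" "c = a ** spec_mat Q d"
    using unitary_quotient[OF assms(2,3)] by metis
  let ?r = "spec_mat Q (\<lambda>i. csqrt (d i))"
  let ?b = "a ** ?r"
  have "?r ** ?r = spec_mat Q d"
    using Q(1) by (simp add: spec_mat_mult flip: power2_eq_square)
  hence c: "?b ** mat_adj a ** ?b = c"
    by (simp add: Q(4) unitary_cancel[OF assms(2)] flip: matrix_mul_assoc)
  have b: "?b \<in> unitaries"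
    using assms Q by (intro unitaries_mult spec_mat_in_unitaries) auto
  have "mat_adj a ** ?b = spec_mat Q (\<lambda>i. csqrt (d i))"
    by (simp add: unitary_cancel assms)
  hence "schatten_dist p a ?b = (\<Sum>i\<in>UNIV. cmod (1 - csqrt (d i)) powr p)"
    using assms Q by (intro schatten_dist_spec_mat)
  also have "\<dots> \<le> (\<Sum>i\<in>UNIV. cmod (1 - d i) powr p)"
    using assms(1) cmod_one_minus_csqrt by (intro sum_mono powr_mono2) auto
  also have "\<dots> = schatten_dist p a c"
    using assms Q by (intro schatten_dist_spec_mat[symmetric])
  finally show ?thesis using that b c by blast
qed

subsection \<open>Isometries preserve reflections\<close>

text \<open>Passing from \<open>T\<close> to \<open>T\<^sup>-\<^sup>1 \<rho> T\<close> displaces \<open>b\<close> by at least \<open>K\<close> times as much, so a bounded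
  \<open>d\<close> forces the displacement to vanish. Vaisala's proof of the Mazur-Ulam theorem rests on this
  argument, which needs no triangle inequality.\<close>

lemma isometry_fixes_centre:
  fixes d :: "'a \<Rightarrow> 'a \<Rightarrow> real"
  assumes T: "bij_betw T L L" "\<And>x y. x \<in> L \<Longrightarrow> y \<in> L \<Longrightarrow> d (T x) (T y) = d x y"
    and \<rho>: "bij_betw \<rho> L L" "\<And>x y. x \<in> L \<Longrightarrow> y \<in> L \<Longrightarrow> d (\<rho> x) (\<rho> y) = d x y"
    and b: "b \<in> L"
    and K: "K > 1" "\<And>x. x \<in> L \<Longrightarrow> K * d x b \<le> d x (\<rho> x)"
    and M: "\<And>x y. x \<in> L \<Longrightarrow> y \<in> L \<Longrightarrow> 0 \<le> d x y \<and> d x y \<le> M"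
    and sym: "\<And>x y. d x y = d y x"
  shows "d (T b) b = 0"
proof -
  have *: "K ^ n * d (T b) b \<le> M"
    if "bij_betw T L L" "\<And>x y. x \<in> L \<Longrightarrow> y \<in> L \<Longrightarrow> d (T x) (T y) = d x y" for n T
    using that
  proof (induction n arbitrary: T)
    case 0
    have "T b \<in> L" using bij_betwE[OF "0.prems"(1)] b by blast
    thus ?case using M b by simp
  next
    case (Suc n)
    define S where "S = inv_into L T \<circ> \<rho> \<circ> T"
    note invT = bij_betw_inv_into[OF Suc.prems(1)]
    have TL: "T x \<in> L" "\<rho> x \<in> L" "inv_into L T x \<in> L" "T (inv_into L T x) = x" if "x \<in> L" for x
      using that bij_betwE[OF Suc.prems(1)] bij_betwE[OF \<rho>(1)] bij_betwE[OF invT]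
        bij_betw_inv_into_right[OF Suc.prems(1)] by blast+
    have dinv: "d (inv_into L T x) (inv_into L T y) = d x y" if "x \<in> L" "y \<in> L" for x y
      using that Suc.prems(2)[of "inv_into L T x" "inv_into L T y"] TL by simp
    have "bij_betw S L L"
      unfolding S_def by (rule bij_betw_trans[OF Suc.prems(1) bij_betw_trans[OF \<rho>(1) invT]])
    moreover have "d (S x) (S y) = d x y" if "x \<in> L" "y \<in> L" for x y
      using that TL by (simp add: S_def dinv \<rho>(2) Suc.prems(2))
    ultimately have "K ^ n * d (S b) b \<le> M"
      by (rule Suc.IH)
    moreover have "K * d (T b) b \<le> d (S b) b"
    proof -
      have "d (S b) b = d (T (S b)) (T b)"
        using Suc.prems(2)[of "S b" b] b TL by (simp add: S_def)
      also have "\<dots> = d (\<rho> (T b)) (T b)"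
        using b TL by (simp add: S_def)
      finally show ?thesis using K(2)[of "T b"] TL b sym by metis
    qed
    hence "K ^ n * (K * d (T b) b) \<le> K ^ n * d (S b) b"
      using K(1) by (intro mult_left_mono) auto
    ultimately show ?case by (simp add: mult_ac)
  qed
  have Tb: "T b \<in> L" using bij_betwE[OF T(1)] b by blast
  show ?thesis
  proof (rule ccontr)
    assume "d (T b) b \<noteq> 0"
    hence pos: "d (T b) b > 0" using M[OF Tb b] by linarith
    obtain n where "M / d (T b) b < K ^ n"
      using real_arch_pow[OF K(1)] by blast
    hence "M < K ^ n * d (T b) b" using pos by (simp add: divide_less_eq)
    thus False using *[OF T, of n] by simp
  qed
qed

text \<open>The analogue in the unitary group of the point reflection \<open>x \<mapsto> 2 b - x\<close>.\<close>

definition refl_at :: "complex^'n^'n \<Rightarrow> complex^'n^'n \<Rightarrow> complex^'n^'n"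
  where "refl_at b x = b ** mat_adj x ** b"

lemma refl_at_in [intro]: "b \<in> unitaries \<Longrightarrow> x \<in> unitaries \<Longrightarrow> refl_at b x \<in> unitaries"
  unfolding refl_at_def by (intro unitaries_mult unitaries_adj)

lemma refl_at_invol: "b \<in> unitaries \<Longrightarrow> refl_at b (refl_at b x) = x"
  unfolding refl_at_def mat_adj_mult mat_adj_adj
  by (simp add: unitary_cancel matrix_mul_assoc unitariesD)

lemma refl_at_self: "b \<in> unitaries \<Longrightarrow> refl_at b b = b"
  unfolding refl_at_def by (simp add: unitary_cancel)

lemma bij_betw_refl_at: "b \<in> unitaries \<Longrightarrow> bij_betw (refl_at b) unitaries unitaries"
  by (rule bij_betw_byWitness[where f' = "refl_at b"]) (auto simp: refl_at_invol)

lemma schatten_dist_refl_at: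
  assumes "0 < p" "b \<in> unitaries" "x \<in> unitaries" "y \<in> unitaries"
  shows "schatten_dist p (refl_at b x) (refl_at b y) = schatten_dist p x y"
  unfolding refl_at_def using assms
  by (simp add: schatten_dist_mult_right schatten_dist_mult_left schatten_dist_adj unitaries_mult unitaries_adj)

text \<open>Two maps must preserve the same neighbourhood of \<open>b\<close>: one that fixes
  \<open>a\<close> and \<open>c\<close>, and the reflection at \<open>b\<close>, which exchanges
  them. Imposing the same radius on both distances serves both.\<close>

lemma bij_betw_equidistant:
  fixes d :: "'a \<Rightarrow> 'a \<Rightarrow> real"
  assumes T: "bij_betw T G G" "\<And>x y. x \<in> G \<Longrightarrow> y \<in> G \<Longrightarrow> d (T x) (T y) = d x y"
    and ac: "a \<in> G" "c \<in> G" "(T a = a \<and> T c = c) \<or> (T a = c \<and> T c = a)"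
    and sym: "\<And>x y. d x y = d y x"
  shows "bij_betw T {x \<in> G. d a x = r \<and> d x c = r} {x \<in> G. d a x = r \<and> d x c = r}"
proof -
  let ?L = "{x \<in> G. d a x = r \<and> d x c = r}"
  have iff: "T x \<in> ?L \<longleftrightarrow> x \<in> ?L" if "x \<in> G" for x
    using ac(3) that T(2)[OF ac(1) that] T(2)[OF that ac(2)] T(2)[OF that ac(1)] T(2)[OF ac(2) that]
      bij_betwE[OF T(1)] sym by (auto; metis)
  have "T ` ?L = ?L"
  proof
    show "T ` ?L \<subseteq> ?L" using iff by blast
    show "?L \<subseteq> T ` ?L"
    proof
      fix y assume y: "y \<in> ?L"
      then obtain x where "x \<in> G" "y = T x"
        using T(1) by (auto simp: bij_betw_def)
      with y iff show "y \<in> T ` ?L" by blast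
    qed
  qed
  moreover have "inj_on T ?L"
    using T(1) by (auto simp: bij_betw_def intro: inj_on_subset)
  ultimately show ?thesis by (simp add: bij_betw_def)
qed

locale unitary_isometry =
  fixes p :: real and \<psi> :: "complex^'n^'n \<Rightarrow> complex^'n^'n"
  assumes p: "0 < p"
    and bij: "bij_betw \<psi> unitaries unitaries"
    and iso: "\<And>U V. U \<in> unitaries \<Longrightarrow> V \<in> unitaries \<Longrightarrow> schatten_dist p (\<psi> U) (\<psi> V) = schatten_dist p U V"
begin

lemma image_in: "U \<in> unitaries \<Longrightarrow> \<psi> U \<in> unitaries"
  using bij_betwE[OF bij] by blast

lemma continuous: "continuous_on unitaries \<psi>"
  unfolding continuous_on_iff
proof (intro ballI allI impI)
  fix U :: "complex^'n^'n" and e :: real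
  assume U: "U \<in> unitaries" and e: "0 < e"
  obtain \<delta> where \<delta>: "0 < \<delta>"
    "\<And>U V :: complex^'n^'n. U \<in> unitaries \<Longrightarrow> V \<in> unitaries \<Longrightarrow> schatten_dist p U V < \<delta> \<Longrightarrow> norm (U - V) < e"
    using norm_small_if_dist_small[OF p e] by blast
  obtain \<eta> where \<eta>: "0 < \<eta>"
    "\<And>U V :: complex^'n^'n. U \<in> unitaries \<Longrightarrow> V \<in> unitaries \<Longrightarrow> norm (U - V) < \<eta> \<Longrightarrow> schatten_dist p U V < \<delta>"
    using schatten_dist_small_if_norm_small[OF p \<delta>(1)] by blast
  show "\<exists>d>0. \<forall>V\<in>unitaries. dist V U < d \<longrightarrow> dist (\<psi> V) (\<psi> U) < e"
    using \<delta> \<eta> U image_in iso by (intro exI[of _ \<eta>]) (simp add: dist_norm)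
qed

text \<open>With \<open>c = refl_at b a\<close> and \<open>b'\<close> the midpoint of \<open>\<psi> a\<close> and \<open>\<psi> c\<close>, the map
  \<open>T = refl_at b \<circ> \<psi>\<^sup>-\<^sup>1 \<circ> refl_at b' \<circ> \<psi>\<close> fixes \<open>a\<close> and \<open>c\<close>, hence \<open>b\<close>; this makes \<open>\<psi> b\<close> a fixed
  point of \<open>refl_at b'\<close> near \<open>b'\<close>, that is, \<open>b'\<close> itself.\<close>

theorem reflection_preserved:
  obtains \<delta> where "0 < \<delta>"
    "\<And>a b. a \<in> unitaries \<Longrightarrow> b \<in> unitaries \<Longrightarrow> schatten_dist p a b < \<delta> \<Longrightarrow>
      \<psi> (refl_at b a) = refl_at (\<psi> b) (\<psi> a)"
proof -
  \<comment> \<open>Two bounds of 1/4 add up to the radius 1/2 on which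
    \<open>schatten_dist_reflection_ge\<close> holds.\<close>
  obtain \<delta>0 where \<delta>0: "0 < \<delta>0"
    "\<And>U V :: complex^'n^'n. U \<in> unitaries \<Longrightarrow> V \<in> unitaries \<Longrightarrow> schatten_dist p U V < \<delta>0 \<Longrightarrow> norm (U - V) < 1/4"
    using norm_small_if_dist_small[OF p, of "1/4"] by auto
  have p2: "1 \<le> 2 powr p" using p by (simp add: ge_one_powr_ge_zero)
  show ?thesis
  \<comment> \<open>The distance from \<open>a\<close> to its reflection is at most
    \<open>2 powr p\<close> times that from \<open>a\<close> to \<open>b\<close>; dividing by this
    factor keeps the midpoint \<open>b'\<close> close to \<open>\<psi> a\<close>.\<close>
  proof (rule that[of "\<delta>0 / 2 powr p"])
    show "0 < \<delta>0 / 2 powr p" using \<delta>0 by simp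
    fix a b :: "complex^'n^'n"
    assume a: "a \<in> unitaries" and b: "b \<in> unitaries" and less: "schatten_dist p a b < \<delta>0 / 2 powr p"
    define c where "c = refl_at b a"
    have c: "c \<in> unitaries" using a b by (auto simp: c_def)
    have ab: "2 powr p * schatten_dist p a b < \<delta>0"
      using less by (simp add: field_simps)
    hence ab': "schatten_dist p a b < \<delta>0"
      using mult_right_mono[OF p2 schatten_dist_nonneg[of p a b]] by simp
    obtain b' where b': "b' \<in> unitaries" "refl_at b' (\<psi> a) = \<psi> c" "schatten_dist p (\<psi> a) b' \<le> schatten_dist p (\<psi> a) (\<psi> c)"
      using unitary_midpoint[OF p image_in[OF a] image_in[OF c]] unfolding refl_at_def by metis
    have "schatten_dist p (\<psi> a) (\<psi> c) \<le> 2 powr p * schatten_dist p a b"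
      using schatten_dist_reflection_le[OF p a b] iso[OF a c] by (simp add: c_def refl_at_def)
    hence "schatten_dist p (\<psi> a) b' < \<delta>0" using b' ab by simp
    hence near1: "norm (\<psi> a - b') < 1/4"
      using \<delta>0 a b' image_in by blast
    have near2: "norm (\<psi> a - \<psi> b) < 1/4"
      using \<delta>0 a b image_in ab' iso by metis
    define \<phi> where "\<phi> = inv_into unitaries \<psi>"
    have \<phi>bij: "bij_betw \<phi> unitaries unitaries"
      unfolding \<phi>_def by (rule bij_betw_inv_into[OF bij])
    have \<phi>in: "\<phi> U \<in> unitaries" if "U \<in> unitaries" for U
      using that bij_betwE[OF \<phi>bij] by blast
    have \<psi>\<phi>: "\<psi> (\<phi> U) = U" and \<phi>\<psi>: "\<phi> (\<psi> U) = U" if "U \<in> unitaries" for U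
      using that unfolding \<phi>_def
      by (simp_all add: bij_betw_inv_into_right[OF bij] bij_betw_inv_into_left[OF bij])
    have \<phi>iso: "schatten_dist p (\<phi> U) (\<phi> V) = schatten_dist p U V" if "U \<in> unitaries" "V \<in> unitaries" for U V
      using iso[OF \<phi>in[OF that(1)] \<phi>in[OF that(2)]] that \<psi>\<phi> by simp
    define T where "T = refl_at b \<circ> (\<phi> \<circ> (refl_at b' \<circ> \<psi>))"
    have Tbij: "bij_betw T unitaries unitaries"
      unfolding T_def using bij \<phi>bij bij_betw_refl_at b b' by (intro bij_betw_trans)
    have Tiso: "schatten_dist p (T x) (T y) = schatten_dist p x y" if "x \<in> unitaries" "y \<in> unitaries" for x y
      using that b b' p by (simp add: T_def schatten_dist_refl_at \<phi>iso iso image_in \<phi>in refl_at_in)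
    have Ta: "T a = a" using a b c by (simp add: T_def b' \<phi>\<psi>) (simp add: c_def refl_at_invol)
    have "refl_at b' (\<psi> c) = \<psi> a" using refl_at_invol[OF b'(1)] b'(2) by metis
    hence Tc: "T c = c" using a b c by (simp add: T_def \<phi>\<psi>) (simp add: c_def)
    define L where "L = {x \<in> unitaries. schatten_dist p a x = schatten_dist p a b \<and> schatten_dist p x c = schatten_dist p a b}"
    have \<rho>a: "refl_at b a = c" "refl_at b c = a"
      using b by (simp_all add: c_def refl_at_invol)
    have "schatten_dist p b c = schatten_dist p (refl_at b b) (refl_at b a)"
      by (simp add: refl_at_self b \<rho>a)
    also have "\<dots> = schatten_dist p a b"
      by (simp add: schatten_dist_refl_at p a b schatten_dist_commute)
    finally have bc: "schatten_dist p b c = schatten_dist p a b" .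
    hence bL: "b \<in> L" by (simp add: L_def b)
    \<comment> \<open>Members of \<open>L\<close> are exactly as far from \<open>a\<close> as
      \<open>b\<close> is, so both lie within 1/4 of \<open>a\<close> in the Frobenius norm.\<close>
    have near: "norm (x - b) \<le> 1/2" if "x \<in> L" for x
    proof -
      have "norm (a - x) < 1/4" "norm (a - b) < 1/4"
        using that \<delta>0 a b ab' by (auto simp: L_def)
      thus ?thesis using norm_triangle_ineq4[of "a - b" "a - x"] by simp
    qed
    have "schatten_dist p (T b) b = 0"
    proof (rule isometry_fixes_centre[where L = L and \<rho> = "refl_at b" and K = "(3/2) powr p"])
      show "bij_betw T L L" unfolding L_def
        by (rule bij_betw_equidistant[where d = "schatten_dist p", OF Tbij Tiso a c]) (auto simp: Ta Tc schatten_dist_commute)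
      show "bij_betw (refl_at b) L L" unfolding L_def
        by (rule bij_betw_equidistant[where d = "schatten_dist p", OF bij_betw_refl_at[OF b] _ a c])
          (auto simp: \<rho>a schatten_dist_commute schatten_dist_refl_at p b)
      show "1 < (3/2::real) powr p" using p by simp
      show "(3/2) powr p * schatten_dist p x b \<le> schatten_dist p x (refl_at b x)" if "x \<in> L" for x
        using schatten_dist_reflection_ge[OF p _ b near[OF that]] that by (simp add: refl_at_def L_def)
      show "0 \<le> schatten_dist p x y \<and> schatten_dist p x y \<le> real CARD('n) * 2 powr p" if "x \<in> L" "y \<in> L" for x y
        using that p by (auto simp: L_def schatten_dist_nonneg intro: schatten_dist_le)
    qed (auto simp: L_def Tiso schatten_dist_refl_at p b bc intro: schatten_dist_commute)
    hence "T b = b" using schatten_dist_eq_0[OF p _ b] bij_betwE[OF Tbij] b by blast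
    hence "\<phi> (refl_at b' (\<psi> b)) = b"
      using refl_at_invol[OF b] refl_at_self[OF b] unfolding T_def comp_def by metis
    hence fixed: "refl_at b' (\<psi> b) = \<psi> b"
      using \<psi>\<phi> b b' image_in by (metis refl_at_in)
    have "norm (\<psi> b - b') \<le> 1/2"
      using near1 near2 norm_triangle_ineq4[of "\<psi> a - b'" "\<psi> a - \<psi> b"] by simp
    \<comment> \<open>The displacement of the fixed point \<open>\<psi> b\<close> is 0, yet it is at
      least \<open>(3/2) powr p\<close> times the distance to \<open>b'\<close>.\<close>
    from schatten_dist_reflection_ge[OF p image_in[OF b] b'(1) this]
    have "(3/2) powr p * schatten_dist p (\<psi> b) b' \<le> 0"
      using fixed schatten_dist_spec_mat[OF p image_in[OF b] unitaries_one, of "\<psi> b" "\<lambda>i. 1"] image_in[OF b]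
      by (simp add: refl_at_def unitariesD spec_mat_one unitaries_one p)
    hence "schatten_dist p (\<psi> b) b' = 0"
      using p schatten_dist_nonneg[of p "\<psi> b" b'] by (simp add: mult_le_0_iff)
    hence "\<psi> b = b'" using schatten_dist_eq_0[OF p image_in[OF b] b'(1)] by simp
    thus "\<psi> (refl_at b a) = refl_at (\<psi> b) (\<psi> a)"
      using b'(2) by (simp add: c_def)
  qed
qed

end

subsection \<open>Rotations about a complex line\<close>

lemma exists_unitary_with_column:
  fixes x :: "complex^'n"
  assumes "norm x = 1"
  obtains Q where "Q \<in> unitaries" "column k Q = x"
proof -
  \<comment> \<open>The index sets always contain \<open>k\<close>, so the prescribed vector belongs
    to the orthonormal family from the start.\<close>
  have "\<exists>v. v k = x \<and> (\<forall>i\<in>insert k I. \<forall>j\<in>insert k I. cip (v i) (v j) = (if i = j then 1 else 0))"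
    for I :: "'n set"
    using finite[of I]
  proof (induction I)
    case empty
    show ?case by (intro exI[of _ "\<lambda>_. x"]) (simp add: cip_self assms)
  next
    case (insert l I)
    then obtain v where v: "v k = x"
      "\<And>i j. i \<in> insert k I \<Longrightarrow> j \<in> insert k I \<Longrightarrow> cip (v i) (v j) = (if i = j then 1 else 0)"
      by blast
    show ?case
    proof (cases "l = k")
      case True
      thus ?thesis using v by auto
    next
      case False
      hence l: "l \<notin> insert k I" using insert by simp
      then obtain w where w: "w \<noteq> 0" "\<And>i. i \<in> insert k I \<Longrightarrow> cip (v i) w = 0"
        using exists_orthogonal_vector[of "insert k I" v] by blast
      define u where "u = (1 / norm w) *\<^sub>R w"
      have u: "cip u u = 1" "cip (v i) u = 0" "cip u (v i) = 0" if "i \<in> insert k I" for i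
        using w that cip_cnj[of "v i" u] by (auto simp: u_def cip_self cip_scaleR_right)
      have "\<forall>i\<in>insert k (insert l I). \<forall>j\<in>insert k (insert l I).
          cip ((v(l := u)) i) ((v(l := u)) j) = (if i = j then 1 else 0)"
        using l v(2) u by auto
      thus ?thesis using v(1) False by (intro exI[of _ "v(l := u)"]) simp
    qed
  qed
  from this[of UNIV] obtain v where v: "v k = x"
    "\<And>i j. cip (v i) (v j) = (if i = j then 1 else 0)" by auto
  show ?thesis
    using that[OF matrix_of_columns_unitary[of v]] v by (simp add: column_def vec_eq_iff)
qed

lemma norm_column_unitary:
  assumes "Q \<in> unitaries"
  shows "norm (column k Q) = 1"
proof -
  have "(mat_adj Q ** Q) $ k $ k = 1"
    using unitariesD[OF assms] by (simp add: mat_def)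
  hence "cip (column k Q) (column k Q) = 1"
    by (simp add: cip_def matrix_matrix_mult_def column_def)
  thus ?thesis by (rule norm_eq_one_if_cip)
qed

text \<open>For a unit vector this is the orthogonal projection onto its complex line. It forgets
  the phase, so vectors can represent lines.\<close>

definition proj :: "complex^'n \<Rightarrow> complex^'n^'n"
  where "proj x = (\<chi> i j. x $ i * cnj (x $ j))"

definition rot :: "complex^'n \<Rightarrow> complex \<Rightarrow> complex^'n^'n"
  where "rot x z = mat 1 + map_matrix ((*) (z - 1)) (proj x)"

lemma rot_column:
  fixes Q :: "complex^'n^'n"
  assumes "Q \<in> unitaries"
  shows "rot (column k Q) z = spec_mat Q ((\<lambda>_. 1)(k := z))"
proof (simp only: vec_eq_iff, intro allI)
  fix i j
  have "spec_mat Q ((\<lambda>_. 1)(k := z)) $ i $ j - spec_mat Q (\<lambda>_. 1) $ i $ j = 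
      (\<Sum>l\<in>UNIV. if l = k then (z - 1) * Q $ i $ k * cnj (Q $ j $ k) else 0)"
    unfolding spec_mat_nth sum_subtractf[symmetric] by (intro sum.cong) (auto simp: algebra_simps)
  thus "rot (column k Q) z $ i $ j = spec_mat Q ((\<lambda>_. 1)(k := z)) $ i $ j"
    unfolding spec_mat_one[OF assms]
    by (simp add: rot_def proj_def column_def algebra_simps)
qed

lemma rot_spec_mat:
  fixes x :: "complex^'n"
  assumes "norm x = 1"
  obtains Q k where "Q \<in> unitaries" "\<And>z. rot x z = spec_mat Q ((\<lambda>_. 1)(k := z))"
  using exists_unitary_with_column[OF assms] rot_column by metis

lemma rot_one [simp]: "rot x 1 = mat 1"
  by (simp add: rot_def vec_eq_iff)

lemma rot_in_unitaries: "norm x = 1 \<Longrightarrow> cmod z = 1 \<Longrightarrow> rot x z \<in> unitaries"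
  using rot_spec_mat[of x] by (metis fun_upd_apply norm_one spec_mat_in_unitaries)

lemma rot_inj: "norm x = 1 \<Longrightarrow> rot x z = rot x w \<Longrightarrow> z = w"
  using rot_spec_mat[of x] by (metis fun_upd_same spec_mat_inj)

lemma schatten_dist_one_rot:
  fixes x :: "complex^'n"
  assumes "0 < p" "norm x = 1"
  shows "schatten_dist p (mat 1) (rot x z) = cmod (1 - z) powr p"
proof -
  obtain Q and k :: 'n where Q: "Q \<in> unitaries" "\<And>z. rot x z = spec_mat Q ((\<lambda>_. 1)(k := z))"
    using rot_spec_mat[OF assms(2)] by metis
  have "schatten_dist p (mat 1) (rot x z) = (\<Sum>i\<in>UNIV. cmod (1 - ((\<lambda>_. 1)(k := z)) i) powr p)"
    using assms Q unitaries_one by (intro schatten_dist_spec_mat[where Q = Q]) (auto simp: fun_upd_def)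
  also have "\<dots> = (\<Sum>i\<in>UNIV. if i = k then cmod (1 - z) powr p else 0)"
    by (intro sum.cong) auto
  finally show ?thesis by simp
qed

lemma proj_eq_iff_rot: "z \<noteq> 1 \<Longrightarrow> rot x z = rot y z \<longleftrightarrow> proj x = proj y"
  by (auto simp: rot_def vec_eq_iff)

lemma rot_cong: "proj x = proj y \<Longrightarrow> rot x z = rot y z"
  by (simp add: rot_def)

lemma trace_rot: "norm x = 1 \<Longrightarrow> trace (rot x z) = of_nat CARD('n) + (z - 1)"
  for x :: "complex^'n"
proof -
  assume "norm x = 1"
  hence "cip x x = 1" by (simp add: cip_self)
  hence "(\<Sum>i\<in>UNIV. x $ i * cnj (x $ i)) = 1" by (simp add: cip_def mult.commute)
  thus ?thesis
    by (simp add: trace_def rot_def proj_def sum.distrib mat_def flip: sum_distrib_left)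
qed

section \<open>Distances on the unit circle\<close>

lemma norm_one_minus_cis: "cmod (1 - cis t) = 2 * \<bar>sin (t / 2)\<bar>"
  using dist_exp_i_1[of t] by (simp add: cis_conv_exp norm_minus_commute)

text \<open>The root with index \<open>k\<close> has distance \<open>2 sin (pi k / m)\<close> from
  1, and for \<open>0 < k < m\<close> the angle lies between \<open>pi / m\<close> and
  \<open>pi - pi / m\<close>, where the sine is smallest at the ends.\<close>

lemma root_of_unity_distance:
  assumes "z ^ m = 1" "z \<noteq> 1" "m > 0"
  shows "cmod (1 - cis (2 * pi / m)) \<le> cmod (1 - z)"
proof -
  have "z \<in> {z. z ^ m = 1}" using assms by simp
  then obtain k where k: "k < m" "z = cis (2 * pi * real k / real m)"
    using Complex.bij_betw_roots_unity[OF assms(3)] unfolding bij_betw_def by blast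
  have k0: "k \<noteq> 0" using k assms(2) by (intro notI) simp
  define a where "a = pi / m"
  have a: "0 < a" "a * real m = pi" using assms(3) by (auto simp: a_def)
  have ka: "a \<le> a * k" "a * k \<le> pi - a"
  proof -
    show "a \<le> a * k" using k0 a by simp
    have "a * real (k + 1) \<le> a * real m"
      using k a by (intro mult_left_mono) auto
    thus "a * k \<le> pi - a" using a by (simp add: algebra_simps)
  qed
  have "sin a \<le> sin (a * k)"
  proof (cases "a * k \<le> pi / 2")
    case True
    thus ?thesis using ka a pi_gt_zero by (intro sin_monotone_2pi_le; linarith)
  next
    case False
    hence "sin a \<le> sin (pi - a * k)"
      using ka a pi_gt_zero by (intro sin_monotone_2pi_le; linarith)
    thus ?thesis by simp
  qed
  moreover have "0 \<le> sin a" using ka a by (intro sin_ge_zero; linarith)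
  ultimately show ?thesis
    unfolding k(2) norm_one_minus_cis by (simp add: a_def mult_ac)
qed

text \<open>On the unit circle \<open>|1 - z|^2 = 2 - 2 Re z\<close>, so the distance from 1
  determines the real part.\<close>

lemma unit_eq_or_cnj:
  assumes "cmod z = 1" "cmod w = 1" "cmod (1 - z) = cmod (1 - w)"
  shows "z = w \<or> z = cnj w"
proof -
  have sq: "(cmod (1 - z))\<^sup>2 = 2 - 2 * Re z" if "cmod z = 1" for z
    using that cmod_power2[of z] cmod_power2[of "1 - z"] by (simp add: power2_eq_square algebra_simps)
  have "Re z = Re w" using assms sq[of z] sq[of w] by simp
  moreover have "(Im z)\<^sup>2 = (Im w)\<^sup>2"
    using assms cmod_power2[of z] cmod_power2[of w] calculation by simp
  ultimately show ?thesis by (auto simp: complex_eq_iff power2_eq_iff)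
qed

section \<open>The distance of two symmetries\<close>

lemma matrix_scaleR_left: "(r *\<^sub>R A) ** B = r *\<^sub>R (A ** (B :: complex^'n^'n))"
  by (simp add: vec_eq_iff matrix_matrix_mult_def scaleR_sum_right)

lemma matrix_scaleR_right: "A ** (r *\<^sub>R B) = r *\<^sub>R (A ** (B :: complex^'n^'n))"
  by (simp add: vec_eq_iff matrix_matrix_mult_def scaleR_sum_right)

lemma matrix_add_rdistrib: "(A + B) ** C = A ** C + B ** (C :: complex^'n^'n)"
  by (simp add: vec_eq_iff matrix_matrix_mult_def distrib_right sum.distrib)

lemma spec_mat_scaleR: "r *\<^sub>R spec_mat Q d = spec_mat Q (\<lambda>i. of_real r * d i)"
  by (simp add: vec_eq_iff spec_mat_nth scaleR_sum_right, simp add: scaleR_conv_of_real[where 'a=complex] mult_ac)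

text \<open>The hypothesis says that the nonzero singular values of \<open>U - V\<close> all equal \<open>sqrt t\<close>.\<close>

lemma schatten_dist_two_valued:
  fixes U V :: "complex^'n^'n"
  assumes p: "0 < p" and U: "U \<in> unitaries" and V: "V \<in> unitaries"
    and B: "B = mat_adj (U - V) ** (U - V)" "B ** B = t *\<^sub>R B"
  shows "schatten_dist p U V = t powr (p / 2 - 1) * (norm (U - V))\<^sup>2"
proof -
  obtain Q d where Q: "Q \<in> unitaries" "mat_adj U ** V = spec_mat Q d"
    using unitary_quotient[OF U V] by metis
  let ?e = "\<lambda>i. cmod (1 - d i)"
  have "B = spec_mat Q (\<lambda>i. of_real ((?e i)\<^sup>2))"
    unfolding B by (rule diff_spec_mat[OF U Q])
  hence "spec_mat Q (\<lambda>i. of_real ((?e i)\<^sup>2) * of_real ((?e i)\<^sup>2)) = spec_mat Q (\<lambda>i. of_real t * of_real ((?e i)\<^sup>2))"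
    using B(2) by (simp only: spec_mat_mult[OF Q(1)] spec_mat_scaleR)
  from spec_mat_inj[OF Q(1) this]
  have "complex_of_real ((?e i)\<^sup>2 * (?e i)\<^sup>2) = of_real (t * (?e i)\<^sup>2)" for i
    unfolding of_real_mult by (rule fun_cong)
  hence e: "(?e i)\<^sup>2 * (?e i)\<^sup>2 = t * (?e i)\<^sup>2" for i
    unfolding of_real_eq_iff .
  \<comment> \<open>Each squared singular value is 0 or \<open>t\<close>. This turns the p-th power
    into a multiple of the square, whose sum a trace can compute.\<close>
  have "?e i powr p = t powr (p / 2 - 1) * (?e i)\<^sup>2" for i
  proof (cases "?e i = 0")
    case False
    hence t: "t = (?e i) powr 2" and pos: "?e i > 0"
      using e[of i] by (simp_all only: mult_cancel_right) auto
    have "t powr (p / 2 - 1) * (?e i)\<^sup>2 = ?e i powr (p - 2) * ?e i powr 2"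
    proof -
      have "2 * (p / 2 - 1) = p - 2" by (simp add: algebra_simps)
      hence "t powr (p / 2 - 1) = ?e i powr (p - 2)"
        unfolding t powr_powr by simp
      thus ?thesis using pos by simp
    qed
    also have "\<dots> = ?e i powr p"
      unfolding powr_add[symmetric] by simp
    finally show ?thesis by simp
  qed simp
  thus ?thesis
    by (simp add: schatten_dist_spec_mat[OF p U Q] norm_diff_spec_mat[OF U Q] sum_distrib_left)
qed

lemma proj_mult: "proj x ** proj y = (\<chi> i j. cip x y * x $ i * cnj (y $ j))"
  by (simp add: vec_eq_iff proj_def matrix_matrix_mult_def cip_def sum_distrib_right sum_distrib_left mult_ac)

lemma proj_mult3: "proj x ** proj y ** proj x = ((cmod (cip x y))\<^sup>2) *\<^sub>R proj x"
proof -
  have "proj x ** proj y ** proj x = (\<chi> i j. cip x y * cip y x * x $ i * cnj (x $ j))"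
    unfolding proj_mult
    by (simp add: vec_eq_iff proj_def matrix_matrix_mult_def cip_def[of y x] sum_distrib_right sum_distrib_left mult_ac)
  also have "cip x y * cip y x = of_real ((cmod (cip x y))\<^sup>2)"
    by (metis cip_cnj complex_norm_square)
  finally show ?thesis
    by (simp add: vec_eq_iff proj_def scaleR_conv_of_real[where 'a=complex] mult_ac)
qed

lemma proj_idem: "norm x = 1 \<Longrightarrow> proj x ** proj x = proj x"
  unfolding proj_mult by (simp add: cip_self) (simp add: proj_def)

lemma trace_proj_mult: "trace (proj x ** proj y) = of_real ((cmod (cip x y))\<^sup>2)"
proof -
  have "trace (proj x ** proj y) = cip x y * cip y x"
    unfolding proj_mult by (simp add: trace_def cip_def[of y x] sum_distrib_left mult_ac)
  thus ?thesis by (metis cip_cnj complex_norm_square)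
qed

lemma trace_proj: "trace (proj x) = of_real ((norm x)\<^sup>2)"
  unfolding cip_self[symmetric] by (simp add: trace_def proj_def cip_def mult.commute)

text \<open>The symmetries differ by twice \<open>R - P\<close>, and \<open>E = (P - R)^2\<close>
  satisfies \<open>E ** E = (1 - c) E\<close>. Hence the nonzero singular values coincide and
  \<open>schatten_dist_two_valued\<close> reduces the distance to a trace.\<close>

lemma schatten_dist_symmetries:
  fixes x y :: "complex^'n"
  assumes p: "0 < p" and x: "norm x = 1" and y: "norm y = 1"
  shows "schatten_dist p (rot x (-1)) (rot y (-1)) = 2 * (4 * (1 - (cmod (cip x y))\<^sup>2)) powr (p / 2)"
    and "(cmod (cip x y))\<^sup>2 \<le> 1"
proof -
  define c where "c = (cmod (cip x y))\<^sup>2"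
  define P where "P = proj x"
  define R where "R = proj y"
  let ?U = "rot x (-1)" and ?V = "rot y (-1)"
  have U: "?U \<in> unitaries" and V: "?V \<in> unitaries"
    using x y by (simp_all add: rot_in_unitaries)
  have c': "c = (cmod (cip y x))\<^sup>2"
    unfolding c_def by (metis cip_cnj complex_mod_cnj)
  have r: "P ** P = P" "R ** R = R" "P ** R ** P = c *\<^sub>R P" "R ** P ** R = c *\<^sub>R R"
    using x y c_def c' by (simp_all only: P_def R_def proj_idem proj_mult3)
  \<comment> \<open>Left-nested products hide the patterns of \<open>r\<close>; with a prefix
    \<open>X\<close> the same reductions apply at the end of any word in \<open>P\<close> and
    \<open>R\<close>.\<close>
  have r2: "X ** P ** P = X ** P" "X ** R ** R = X ** R"
    "X ** P ** R ** P = c *\<^sub>R (X ** P)" "X ** R ** P ** R = c *\<^sub>R (X ** R)" for X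
  proof -
    have "X ** P ** P = X ** (P ** P)" "X ** R ** R = X ** (R ** R)"
      "X ** P ** R ** P = X ** (P ** R ** P)" "X ** R ** P ** R = X ** (R ** P ** R)"
      by (simp_all only: matrix_mul_assoc)
    thus "X ** P ** P = X ** P" "X ** R ** R = X ** R"
      "X ** P ** R ** P = c *\<^sub>R (X ** P)" "X ** R ** P ** R = c *\<^sub>R (X ** R)"
      by (simp_all only: r matrix_scaleR_right)
  qed
  have diff: "?U - ?V = 2 *\<^sub>R (R - P)"
    by (simp add: vec_eq_iff rot_def P_def R_def scaleR_conv_of_real[where 'a=complex] algebra_simps)
  define E where "E = P + R - P ** R - R ** P"
  have adj: "mat_adj (2 *\<^sub>R (R - P)) = 2 *\<^sub>R (R - P)"
    by (simp add: vec_eq_iff P_def R_def proj_def scaleR_conv_of_real[where 'a=complex] mult.commute)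
  have B: "mat_adj (?U - ?V) ** (?U - ?V) = 4 *\<^sub>R E"
    unfolding diff adj
    by (simp add: matrix_scaleR_left matrix_scaleR_right matrix_diff_ldistrib matrix_diff_rdistrib r E_def
        algebra_simps)
  have EE: "E ** E = (1 - c) *\<^sub>R E"
    unfolding E_def
    by (simp add: matrix_scaleR_left matrix_scaleR_right matrix_diff_ldistrib matrix_diff_rdistrib
        matrix_add_ldistrib matrix_add_rdistrib matrix_mul_assoc r r2 algebra_simps)
  have "trace E = of_real (2 - 2 * c)"
  proof -
    have "trace E = trace P + trace R - trace (P ** R) - trace (R ** P)"
      by (simp add: E_def trace_def sum.distrib sum_subtractf)
    thus ?thesis
      using x y by (simp add: P_def R_def trace_proj trace_proj_mult c_def[symmetric] c'[symmetric])
  qed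
  moreover have "trace (4 *\<^sub>R E) = 4 * trace E"
    by (simp add: trace_def scaleR_conv_of_real[where 'a=complex] sum_distrib_left)
  ultimately have nrm: "(norm (?U - ?V))\<^sup>2 = 2 * (4 * (1 - c))"
    unfolding norm_eq_trace B by simp
  \<comment> \<open>The Cauchy-Schwarz bound for unit vectors falls out of the nonnegativity of the
    Frobenius norm.\<close>
  hence "0 \<le> 2 * (4 * (1 - c))" by (metis zero_le_power2)
  hence c1: "c \<le> 1" by simp
  thus "(cmod (cip x y))\<^sup>2 \<le> 1" by (simp add: c_def)
  have "(4 *\<^sub>R E) ** (4 *\<^sub>R E) = (4 * (1 - c)) *\<^sub>R (4 *\<^sub>R E)"
    by (simp add: matrix_scaleR_left matrix_scaleR_right EE)
  from schatten_dist_two_valued[OF p U V B[symmetric] this]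
  have "schatten_dist p ?U ?V = 2 * ((4 * (1 - c)) powr (p / 2 - 1) * (4 * (1 - c)))"
    unfolding nrm by simp
  \<comment> \<open>For \<open>c = 1\<close> the left side has a factor 0 and the right side is
    \<open>0 powr (p / 2) = 0\<close>.\<close>
  also have "(4 * (1 - c)) powr (p / 2 - 1) * (4 * (1 - c)) = (4 * (1 - c)) powr (p / 2)"
    using c1 powr_add[of "4 * (1 - c)" "p / 2 - 1" 1] by (cases "c = 1") simp_all
  finally show "schatten_dist p ?U ?V = 2 * (4 * (1 - (cmod (cip x y))\<^sup>2)) powr (p / 2)"
    by (simp add: c_def)
qed

lemma schatten_dist_symmetries_inj:
  fixes x y u v :: "complex^'n"
  assumes p: "0 < p" and "norm x = 1" "norm y = 1" "norm u = 1" "norm v = 1"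
    and eq: "schatten_dist p (rot x (-1)) (rot y (-1)) = schatten_dist p (rot u (-1)) (rot v (-1))"
  shows "cmod (cip x y) = cmod (cip u v)"
proof -
  have "(4 * (1 - (cmod (cip x y))\<^sup>2)) powr (p / 2) = (4 * (1 - (cmod (cip u v))\<^sup>2)) powr (p / 2)"
    using eq unfolding schatten_dist_symmetries(1)[OF p assms(2,3)] schatten_dist_symmetries(1)[OF p assms(4,5)] by simp
  hence "4 * (1 - (cmod (cip x y))\<^sup>2) = 4 * (1 - (cmod (cip u v))\<^sup>2)"
    using p schatten_dist_symmetries(2)[OF p assms(2,3)] schatten_dist_symmetries(2)[OF p assms(4,5)]
      powr_less_mono2[of "p/2" "4 * (1 - (cmod (cip x y))\<^sup>2)" "4 * (1 - (cmod (cip u v))\<^sup>2)"]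
      powr_less_mono2[of "p/2" "4 * (1 - (cmod (cip u v))\<^sup>2)" "4 * (1 - (cmod (cip x y))\<^sup>2)"]
    by (smt (verit) divide_pos_pos)
  thus ?thesis by (simp add: power2_eq_iff_nonneg)
qed

section \<open>Coordinates, lines and overlaps\<close>

lemma cip_axis: "cip (axis i 1) x = x $ i"
proof -
  have "cip (axis i 1) x = (\<Sum>j\<in>UNIV. if j = i then x $ j else 0)"
    unfolding cip_def axis_def by (intro sum.cong) auto
  thus ?thesis by simp
qed

lemma cip_supported:
  assumes "\<And>i. i \<notin> S \<Longrightarrow> x $ i = 0"
  shows "cip x y = (\<Sum>i\<in>S. cnj (x $ i) * y $ i)"
  unfolding cip_def by (rule sum.mono_neutral_right) (auto simp: assms)

text \<open>The equality case of Cauchy-Schwarz: \<open>w - c u\<close> has norm 0, and the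
  unimodular \<open>c\<close> drops out of the projection.\<close>

lemma proj_eq_if_cip:
  assumes "norm u = 1" "norm w = 1" "cmod (cip u w) = 1"
  shows "proj w = proj u"
proof -
  define c where "c = cip u w"
  have cc: "c * cnj c = 1"
    using assms(3) complex_norm_square[of c] by (simp add: c_def)
  have 1: "cip u u = 1" "cip w w = 1" using assms by (simp_all add: cip_self)
  have wu: "cip w u = cnj c" by (simp add: c_def cip_cnj)
  have "cip (w - c *s u) (w - c *s u) = cip w w - c * cip w u - cnj c * cip u w + cnj c * c * cip u u"
    by (simp add: cip_def sum_subtractf sum.distrib sum_distrib_left algebra_simps)
  also have "\<dots> = 0" using cc unfolding 1 wu c_def[symmetric] by (simp add: mult.commute)
  finally have "w = c *s u" by (simp add: cip_self)
  hence "proj w $ i $ j = (c * cnj c) * proj u $ i $ j" for i j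
    by (simp add: proj_def mult_ac)
  thus ?thesis by (simp add: vec_eq_iff cc)
qed

lemma proj_matrix_vector: "proj (A *v x) = A ** proj x ** mat_adj A"
proof -
  have 1: "(A ** proj x) $ i $ k = (A *v x) $ i * cnj (x $ k)" for i k
    by (simp add: proj_def matrix_matrix_mult_def matrix_vector_mult_def sum_distrib_right sum_distrib_left mult_ac)
  have "(A ** proj x ** mat_adj A) $ i $ j = (\<Sum>k\<in>UNIV. (A ** proj x) $ i $ k * mat_adj A $ k $ j)" for i j
    by (simp add: matrix_matrix_mult_def)
  also have "\<dots> i j = (A *v x) $ i * cnj ((A *v x) $ j)" for i j
    unfolding 1 by (simp add: matrix_vector_mult_def[of A x] sum_distrib_left mult_ac)
  finally show ?thesis
    by (simp add: vec_eq_iff) (simp add: proj_def)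
qed

text \<open>The mixed term depends only on the products \<open>cnj a * b\<close> and
  \<open>cnj w * z\<close>, which ignore a common phase of \<open>(a, b)\<close> or of
  \<open>(w, z)\<close>.\<close>

lemma cmod_square_two_terms:
  "(cmod (cnj a * w + cnj b * z))\<^sup>2 = (cmod a)\<^sup>2 * (cmod w)\<^sup>2 + (cmod b)\<^sup>2 * (cmod z)\<^sup>2
     + 2 * Re (cnj (cnj a * b) * (cnj w * z))"
  unfolding cmod_power2 by (simp add: power2_eq_square algebra_simps)

subsection \<open>Wigner's theorem\<close>

text \<open>One Boolean carries the alternative between identity and conjugation, both for entries
  of projections and for eigenvalues, so each argument is made once.\<close>

definition cnj_if :: "bool \<Rightarrow> complex \<Rightarrow> complex"
  where "cnj_if s z = (if s then cnj z else z)"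

lemma cnj_if_simps [simp]:
  "cnj_if s (z * w) = cnj_if s z * cnj_if s w"
  "cnj_if s (cnj z) = cnj (cnj_if s z)"
  "cmod (cnj_if s z) = cmod z"
  "cnj_if s 1 = 1" "cnj_if s 0 = 0"
  "cnj_if s (of_real r) = of_real r"
  "cnj_if s (z ^ n) = cnj_if s z ^ n"
  by (simp_all add: cnj_if_def)

text \<open>A Wigner map normalized so that it preserves the lines spanned by the standard basis vectors.
  Modulo the phase of \<open>h x\<close>, everything is expressed through the phase-free products with the
  \<open>k\<close>-th coordinate, called \<open>q\<close> below.\<close>

locale wigner_map =
  fixes h :: "complex^'n \<Rightarrow> complex^'n" and k :: 'n
  assumes norm_h: "\<And>x. norm x = 1 \<Longrightarrow> norm (h x) = 1"
    and cip_h: "\<And>x y. norm x = 1 \<Longrightarrow> norm y = 1 \<Longrightarrow> cmod (cip (h x) (h y)) = cmod (cip x y)"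
    and nth_h: "\<And>x i. norm x = 1 \<Longrightarrow> cmod (h x $ i) = cmod (x $ i)"
begin

definition q :: "complex^'n \<Rightarrow> 'n \<Rightarrow> complex"
  where "q x j = cnj (x $ k) * x $ j"

lemma cmod_q_h: "norm x = 1 \<Longrightarrow> cmod (q (h x) j) = cmod (q x j)"
  by (simp add: q_def norm_mult nth_h)

lemma q_self: "norm x = 1 \<Longrightarrow> q (h x) k = q x k"
  unfolding q_def using nth_h[of x k] by (metis complex_norm_square mult.commute)

lemma cip_q: "x $ k * cnj (y $ k) * cip x y = (\<Sum>j\<in>UNIV. cnj (q x j) * q y j)"
  by (simp add: cip_def q_def sum_distrib_left mult_ac)

text \<open>The overlap with \<open>s\<close> involves just the coordinates \<open>k\<close> and
  \<open>j\<close>. As its modulus and all coordinate moduli are preserved, so is the mixed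
  term.\<close>

lemma two_coordinates:
  assumes x: "norm x = 1" and s: "norm s = 1" "\<And>i. i \<noteq> k \<Longrightarrow> i \<noteq> j \<Longrightarrow> s $ i = 0" and "j \<noteq> k"
  shows "Re (cnj (q (h s) j) * q (h x) j) = Re (cnj (q s j) * q x j)"
proof -
  have *: "cip u y = cnj (u $ k) * y $ k + cnj (u $ j) * y $ j"
    if "\<And>i. i \<noteq> k \<Longrightarrow> i \<noteq> j \<Longrightarrow> u $ i = 0" for u y
    using that \<open>j \<noteq> k\<close> by (subst cip_supported[where S = "{k, j}"]) auto
  have hs: "h s $ i = 0" if "i \<noteq> k" "i \<noteq> j" for i
    using nth_h[OF s(1), of i] s(2)[OF that] by simp
  have c: "cip (h s) y = cnj (h s $ k) * y $ k + cnj (h s $ j) * y $ j"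
    "cip s y = cnj (s $ k) * y $ k + cnj (s $ j) * y $ j" for y
    by (simp_all add: *[of "h s"] *[of s] hs s(2))
  have "(cmod (cip (h s) (h x)))\<^sup>2 = (cmod (cip s x))\<^sup>2"
    using cip_h[OF s(1) x] by simp
  thus ?thesis
    unfolding c cmod_square_two_terms q_def by (simp add: nth_h x s(1))
qed

definition pair :: "'n \<Rightarrow> complex \<Rightarrow> complex^'n"
  where "pair j a = (\<chi> i. if i = k then 1 / of_real (sqrt 2) else if i = j then a / of_real (sqrt 2) else 0)"

lemma norm_supported:
  assumes "\<And>i. i \<notin> S \<Longrightarrow> x $ i = (0::complex)" "(\<Sum>i\<in>S. (cmod (x $ i))\<^sup>2) = 1"
  shows "norm (x :: complex^'n) = 1"
proof -
  have "(\<Sum>i\<in>UNIV. (cmod (x $ i))\<^sup>2) = (\<Sum>i\<in>S. (cmod (x $ i))\<^sup>2)"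
    by (rule sum.mono_neutral_right) (auto simp: assms)
  thus ?thesis by (simp add: norm_vec_def L2_set_def assms)
qed

lemma pair:
  assumes "j \<noteq> k" "cmod a = 1"
  shows "norm (pair j a) = 1" "q (pair j a) j = a / 2"
    and "\<And>i. i \<noteq> k \<Longrightarrow> i \<noteq> j \<Longrightarrow> pair j a $ i = 0"
proof -
  show "norm (pair j a) = 1"
    by (rule norm_supported[of "{k, j}"]) (use assms in \<open>auto simp: pair_def norm_divide power_divide\<close>)
  have "of_real (sqrt 2) * of_real (sqrt 2) = (2 :: complex)"
    by (simp flip: of_real_mult)
  thus "q (pair j a) j = a / 2"
    using assms by (simp add: q_def pair_def)
qed (simp add: pair_def)

text \<open>The probes \<open>pair j 1\<close> and \<open>pair j \<i>\<close> reveal the real and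
  the imaginary part of \<open>q x j\<close>, measured along the unimodular directions
  \<open>d\<close> and \<open>e\<close>. Testing one probe against the other leaves
  \<open>e = i d\<close> or \<open>e = - i d\<close>, the linear and the conjugate case.\<close>

lemma coordinate_rule:
  assumes j: "j \<noteq> k"
  obtains d s where "cmod d = 1" "\<And>x. norm x = 1 \<Longrightarrow> q (h x) j = d * cnj_if s (q x j)"
proof -
  \<comment> \<open>The factor 2 makes \<open>d\<close> unimodular, because
    \<open>q (pair j a) j\<close> equals \<open>a / 2\<close>.\<close>
  define d where "d = 2 * q (h (pair j 1)) j"
  define e where "e = 2 * q (h (pair j \<i>)) j"
  have d: "cmod d = 1" and e: "cmod e = 1"
    unfolding d_def e_def norm_mult cmod_q_h[OF pair(1)[OF j norm_one]] cmod_q_h[OF pair(1)[OF j norm_ii]]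
      pair(2)[OF j norm_one] pair(2)[OF j norm_ii] by simp_all
  have re: "Re (cnj d * q (h x) j) = Re (q x j)" if "norm x = 1" for x
    using two_coordinates[OF that pair(1)[OF j] pair(3)[OF j] j, of 1] pair(2)[OF j, of 1]
    by (simp add: d_def)
  have im: "Re (cnj e * q (h x) j) = Im (q x j)" if "norm x = 1" for x
    using two_coordinates[OF that pair(1)[OF j] pair(3)[OF j] j, of \<i>] pair(2)[OF j, of \<i>]
    by (simp add: e_def)
  define f where "f = cnj d * e"
  have "Re f = 0"
    using re[OF pair(1)[OF j, of \<i>]] pair(2)[OF j, of \<i>] by (simp add: e_def f_def)
  moreover have "cmod f = 1" by (simp add: f_def norm_mult d e)
  ultimately have "Im f = 1 \<or> Im f = -1"
    using cmod_power2[of f] by (simp add: power2_eq_1_iff)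
  hence f: "f = \<i> \<or> f = -\<i>" using \<open>Re f = 0\<close> by (auto simp: complex_eq_iff)
  have dd: "d * cnj d = 1" using d complex_norm_square[of d] by simp
  have e': "e = d * f"
    using dd by (simp add: f_def mult.assoc[symmetric])
  have "q (h x) j = d * cnj_if (f = -\<i>) (q x j)" if "norm x = 1" for x
  proof -
    define z where "z = cnj d * q (h x) j"
    have 1: "Re z = Re (q x j)" using re[OF that] by (simp add: z_def)
    have "Re (cnj f * z) = Im (q x j)"
      using im[OF that] by (simp add: z_def e' mult_ac)
    hence "z = cnj_if (f = -\<i>) (q x j)"
      using f 1 by (auto simp: cnj_if_def complex_eq_iff)
    moreover have "d * z = q (h x) j"
      using dd by (simp add: z_def mult.assoc[symmetric])
    ultimately show ?thesis by metis
  qed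
  thus ?thesis using that d by blast
qed

text \<open>The vectors \<open>t 1\<close> and \<open>t \<i>\<close> of the proof exclude that one coordinate is conjugated and another
  is not.\<close>

lemma uniform_rule:
  obtains d s where "\<And>j. cmod (d j) = 1"
    "\<And>x j. norm x = 1 \<Longrightarrow> q (h x) j = d j * cnj_if s (q x j)" "d k = 1"
proof -
  have "\<forall>j. \<exists>d s. j \<noteq> k \<longrightarrow> cmod d = 1 \<and> (\<forall>x. norm x = 1 \<longrightarrow> q (h x) j = d * cnj_if s (q x j))"
    using coordinate_rule by metis
  then obtain d s where ds: "\<And>j. j \<noteq> k \<Longrightarrow> cmod (d j) = 1"
    "\<And>j x. j \<noteq> k \<Longrightarrow> norm x = 1 \<Longrightarrow> q (h x) j = d j * cnj_if (s j) (q x j)"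
    by metis
  have qk: "cnj_if b (q x k) = q x k" for b x
    by (simp add: q_def mult.commute cnj_if_def)
  have same: "s j = s l" if "j \<noteq> k" "l \<noteq> k" for j l
  proof (rule ccontr)
    assume neq: "s j \<noteq> s l"
    hence jl: "j \<noteq> l" by blast
    define t where "t a = (\<chi> i. if i = k then 1 / of_real (sqrt 3) else if i = j \<or> i = l then a / of_real (sqrt 3) else (0::complex))" for a
    have nt: "norm (t a) = 1" if "cmod a = 1" for a
      by (rule norm_supported[of "{k, j, l}"])
        (use that \<open>j \<noteq> k\<close> \<open>l \<noteq> k\<close> jl in \<open>auto simp: t_def norm_divide power_divide\<close>)
    have s3: "of_real (sqrt 3) * of_real (sqrt 3) = (3 :: complex)"
      by (simp flip: of_real_mult)
    have qt: "q (t a) k = 1/3" "q (t a) j = a/3" "q (t a) l = a/3" "i \<notin> {k,j,l} \<Longrightarrow> q (t a) i = 0" for a i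
      using \<open>j \<noteq> k\<close> \<open>l \<noteq> k\<close> s3 by (simp_all add: q_def t_def)
    have sum3: "(\<Sum>i\<in>UNIV. f i) = f k + f j + f l" if "\<And>i. i \<notin> {k,j,l} \<Longrightarrow> f i = (0::complex)" for f
    proof -
      have "(\<Sum>i\<in>UNIV. f i) = (\<Sum>i\<in>{k,j,l}. f i)"
        by (rule sum.mono_neutral_right) (auto simp: that)
      thus ?thesis using \<open>j \<noteq> k\<close> \<open>l \<noteq> k\<close> jl by (simp add: add.assoc)
    qed
    have n: "norm (t 1) = 1" "norm (t \<i>) = 1" by (simp_all add: nt)
    have "cmod (h (t 1) $ k * cnj (h (t \<i>) $ k) * cip (h (t 1)) (h (t \<i>)))
        = cmod (t 1 $ k * cnj (t \<i> $ k) * cip (t 1) (t \<i>))"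
      by (simp add: norm_mult nth_h n cip_h)
    hence eq: "cmod (\<Sum>i\<in>UNIV. cnj (q (h (t 1)) i) * q (h (t \<i>)) i) = cmod (\<Sum>i\<in>UNIV. cnj (q (t 1) i) * q (t \<i>) i)"
      unfolding cip_q .
    have 1: "(\<Sum>i\<in>UNIV. cnj (q (t 1) i) * q (t \<i>) i) = 1/9 + 2 * \<i> / 9"
      by (subst sum3) (simp_all add: qt)
    have dd: "cnj (d i) * d i = 1" if "i \<noteq> k" for i
      using ds(1)[OF that] complex_norm_square[of "d i"] by (simp add: mult.commute)
    have 2: "cnj (q (h (t 1)) i) * q (h (t \<i>)) i = cnj (cnj_if (s i) (q (t 1) i)) * cnj_if (s i) (q (t \<i>) i)"
      if "i \<noteq> k" for i
    proof -
      have "cnj (d i * a) * (d i * b) = (cnj (d i) * d i) * (cnj a * b)" for a b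
        by (simp add: mult_ac)
      thus ?thesis unfolding ds(2)[OF that n(1)] ds(2)[OF that n(2)] by (simp only: dd[OF that] mult_1)
    qed
    have "(\<Sum>i\<in>UNIV. cnj (q (h (t 1)) i) * q (h (t \<i>)) i) = 
        1/9 + cnj_if (s j) (\<i> / 3) / 3 + cnj_if (s l) (\<i> / 3) / 3"
    proof (subst sum3)
      fix i assume "i \<notin> {k,j,l}"
      thus "cnj (q (h (t 1)) i) * q (h (t \<i>)) i = 0"
        using 2[of i] qt(4)[of i] by simp
    qed (use \<open>j \<noteq> k\<close> \<open>l \<noteq> k\<close> in \<open>simp add: 2 qt q_self n cnj_if_def\<close>)
    \<comment> \<open>With opposite rules the contributions \<open>i/9\<close> and
      \<open>-i/9\<close> cancel, whereas the preserved modulus is that of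
      \<open>(1 + 2 i) / 9\<close>.\<close>
    also have "\<dots> = 1/9"
      using neq by (auto simp: cnj_if_def)
    finally have "cmod (1/9) = cmod (1/9 + 2 * \<i> / 9)"
      by (metis eq 1)
    hence "(cmod (1/9 + 2 * \<i> / 9))\<^sup>2 = (cmod (1/9))\<^sup>2" by simp
    thus False unfolding cmod_power2 by (simp add: power2_eq_square)
  qed
  obtain b where b: "\<And>j. j \<noteq> k \<Longrightarrow> s j = b"
    using same by metis
  show ?thesis
  \<comment> \<open>At \<open>k\<close> itself \<open>q x k\<close> is real and preserved, so the
    factor 1 fits either value of \<open>b\<close>.\<close>
  proof (rule that[of "d(k := 1)" b])
    show "cmod ((d(k := 1)) j) = 1" for j using ds(1) by simp
    show "q (h x) j = (d(k := 1)) j * cnj_if b (q x j)" if "norm x = 1" for x j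
      using ds(2)[OF _ that, of j] b[of j] q_self[OF that] qk by (cases "j = k") simp_all
  qed simp
qed

lemma norm_cnj_if: "norm ((\<chi> i. d i * cnj_if s (x $ i)) :: complex^'n) = norm x"
  if "\<And>j. cmod (d j) = 1"
  by (simp add: norm_vec_def L2_set_def norm_mult that)

text \<open>If \<open>x $ k\<close> is nonzero, the products of the \<open>q x i\<close> determine
  the projection. If it is zero they all vanish, and the unit vector \<open>y\<close>, namely
  \<open>x\<close> plus the k-th basis vector divided by \<open>sqrt 2\<close>, is used instead: its
  overlap with \<open>x\<close> forces \<open>h x\<close> into the predicted line.\<close>

lemma proj_rule:
  obtains d s where "\<And>j. cmod (d j) = 1"
    "\<And>x. norm x = 1 \<Longrightarrow> proj (h x) = proj (\<chi> i. d i * cnj_if s (x $ i))"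
proof -
  obtain d s where d: "\<And>j. cmod (d j) = 1"
    and ds: "\<And>x j. norm x = 1 \<Longrightarrow> q (h x) j = d j * cnj_if s (q x j)" and dk: "d k = 1"
    using uniform_rule by metis
  have "proj (h x) = proj (\<chi> i. d i * cnj_if s (x $ i))" if x: "norm x = 1" for x
  proof (cases "x $ k = 0")
    case False
    have "proj (h x) $ i $ j = proj (\<chi> i. d i * cnj_if s (x $ i)) $ i $ j" for i j
    proof -
      have 1: "q y i * cnj (q y j) = of_real ((cmod (y $ k))\<^sup>2) * proj y $ i $ j" for y
        unfolding complex_norm_square by (simp add: q_def proj_def mult_ac)
      have "of_real ((cmod (x $ k))\<^sup>2) * proj (h x) $ i $ j = q (h x) i * cnj (q (h x) j)"
        by (simp add: 1 nth_h x)
      also have "\<dots> = d i * cnj (d j) * cnj_if s (q x i * cnj (q x j))"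
        by (simp add: ds x mult_ac)
      also have "\<dots> = of_real ((cmod (x $ k))\<^sup>2) * proj (\<chi> i. d i * cnj_if s (x $ i)) $ i $ j"
        unfolding 1 by (simp add: proj_def mult_ac)
      finally show ?thesis using False by simp
    qed
    thus ?thesis by (simp add: vec_eq_iff)
  next
    case True
    let ?u = "\<chi> i. d i * cnj_if s (x $ i)"
    define y where "y = (\<chi> i. if i = k then 1 / of_real (sqrt 2) else x $ i / (of_real (sqrt 2) :: complex))"
    have nx: "(\<Sum>i\<in>UNIV. (cmod (x $ i))\<^sup>2) = 1"
      using x by (simp add: norm_vec_def L2_set_def)
    have "(\<Sum>i\<in>UNIV. (cmod (y $ i))\<^sup>2) = (\<Sum>i\<in>UNIV. (if i = k then 1 / 2 else 0) + (cmod (x $ i))\<^sup>2 / 2)"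
      by (intro sum.cong) (auto simp: y_def True norm_divide power_divide)
    also have "\<dots> = 1"
      using nx by (simp add: sum.distrib flip: sum_divide_distrib)
    finally have ny: "norm y = 1" by (simp add: norm_vec_def L2_set_def)
    have "cip y x = (\<Sum>i\<in>UNIV. cnj (x $ i) * x $ i / of_real (sqrt 2))"
      unfolding cip_def by (intro sum.cong) (auto simp: y_def True)
    also have "\<dots> = cip x x / of_real (sqrt 2)"
      by (simp add: cip_def sum_divide_distrib)
    finally have "cmod (cip (h y) (h x)) = 1 / sqrt 2"
      using x ny by (simp add: cip_h cip_self norm_divide)
    moreover have "cmod (h y $ k) = 1 / sqrt 2"
      using ny by (simp add: nth_h) (simp add: y_def norm_divide)
    ultimately have "cmod (h y $ k * cip (h y) (h x)) = 1 / 2"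
      by (simp add: norm_mult)
    moreover have "h y $ k * cip (h y) (h x) = cip ?u (h x) / 2"
    proof -
      have hxk: "h x $ k = 0" using nth_h[OF x, of k] True by simp
      have s2: "of_real (sqrt 2) * of_real (sqrt 2) = (2 :: complex)"
        by (simp flip: of_real_mult)
      have "h y $ k * (cnj (h y $ i) * h x $ i) = cnj (?u $ i) * h x $ i / 2" for i
      proof (cases "i = k")
        case False
        have "h y $ k * cnj (h y $ i) = cnj (q (h y) i)" by (simp add: q_def)
        also have "\<dots> = cnj (d i * cnj_if s (x $ i / 2))"
          using False s2 by (simp add: ds ny) (simp add: q_def y_def)
        also have "\<dots> = cnj (?u $ i) / 2"
          by (simp add: cnj_if_def)
        finally show ?thesis by (simp add: mult.assoc[symmetric])
      qed (simp add: hxk)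
      thus ?thesis
        unfolding cip_def sum_distrib_left sum_divide_distrib by (rule sum.cong[OF refl])
    qed
    ultimately have "cmod (cip ?u (h x)) = 1" by (simp add: norm_divide)
    moreover have "norm ?u = 1" using x d by (simp add: norm_cnj_if)
    ultimately show ?thesis using proj_eq_if_cip norm_h[OF x] by blast
  qed
  thus ?thesis using that d by blast
qed

end

text \<open>The images of the standard basis are orthonormal. Undoing the unitary \<open>V\<close>
  they form gives a map preserving all coordinate moduli, as \<open>wigner_map\<close> demands, and
  the phases found there enter \<open>W\<close> as a diagonal factor.\<close>

theorem wigner:
  fixes g :: "complex^'n \<Rightarrow> complex^'n"
  assumes norm_g: "\<And>x. norm x = 1 \<Longrightarrow> norm (g x) = 1"
    and cip_g: "\<And>x y. norm x = 1 \<Longrightarrow> norm y = 1 \<Longrightarrow> cmod (cip (g x) (g y)) = cmod (cip x y)"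
  obtains W s where "W \<in> unitaries"
    "\<And>x. norm x = 1 \<Longrightarrow> proj (g x) = W ** map_matrix (cnj_if s) (proj x) ** mat_adj W"
proof -
  have na: "norm (axis i 1 :: complex^'n) = 1" for i by simp
  define V where "V = (\<chi> i j. g (axis j 1) $ i)"
  have V: "V \<in> unitaries" unfolding V_def
  proof (rule matrix_of_columns_unitary)
    fix i j :: 'n
    have "cmod (cip (g (axis i 1)) (g (axis j 1))) = cmod ((axis j 1 :: complex^'n) $ i)"
      by (simp add: cip_g cip_axis)
    thus "cip (g (axis i 1)) (g (axis j 1)) = (if i = j then 1 else 0)"
      by (cases "i = j") (simp_all only: cip_self norm_g[OF na] if_True if_False, simp_all add: axis_def)
  qed
  define h where "h x = mat_adj V *v g x" for x
  have cip_h: "cip (h x) (h y) = cip (g x) (g y)" for x y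
    unfolding h_def cip_adj by (simp add: matrix_vector_mul_assoc unitariesD[OF V])
  have "wigner_map h"
  proof
    show "norm (h x) = 1" if "norm x = 1" for x
      by (rule norm_eq_one_if_cip, simp only: cip_h) (simp add: cip_self norm_g[OF that])
    show "cmod (cip (h x) (h y)) = cmod (cip x y)" if "norm x = 1" "norm y = 1" for x y
      using cip_g that cip_h by simp
    show "cmod (h x $ i) = cmod (x $ i)" if "norm x = 1" for x i
    proof -
      have "h x $ i = cip (g (axis i 1)) (g x)"
        by (simp add: h_def cip_def matrix_vector_mult_def V_def)
      thus ?thesis using cip_g[OF na that] by (simp add: cip_axis)
    qed
  qed
  then interpret wigner_map h k for k .
  obtain d s where d: "\<And>j. cmod (d j) = 1"
    and ds: "\<And>x. norm x = 1 \<Longrightarrow> proj (h x) = proj (\<chi> i. d i * cnj_if s (x $ i))"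
    using proj_rule by metis
  have D: "diag_mat d \<in> unitaries"
    using spec_mat_in_unitaries[OF unitaries_one, of d] d by (simp add: spec_mat_def)
  show ?thesis
  proof (rule that[of "V ** diag_mat d" s])
    show "V ** diag_mat d \<in> unitaries" using V D by (rule unitaries_mult)
    fix x :: "complex^'n" assume x: "norm x = 1"
    have "V *v h x = g x"
      by (simp add: h_def matrix_vector_mul_assoc unitariesD[OF V])
    hence "proj (g x) = V ** proj (h x) ** mat_adj V"
      by (metis proj_matrix_vector)
    also have "proj (h x) = diag_mat d ** map_matrix (cnj_if s) (proj x) ** mat_adj (diag_mat d)"
      unfolding ds[OF x] mat_adj_diag
      by (simp add: vec_eq_iff diag_mat_mult_left diag_mat_mult_right proj_def mult_ac)
    finally show "proj (g x) = V ** diag_mat d ** map_matrix (cnj_if s) (proj x) ** mat_adj (V ** diag_mat d)"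
      by (simp add: mat_adj_mult matrix_mul_assoc)
  qed
qed

subsection \<open>Isometries fixing the identity\<close>

lemma schatten_dist_one_spec_mat:
  assumes "0 < p" "Q \<in> unitaries"
  shows "schatten_dist p (mat 1) (spec_mat Q d) = (\<Sum>i\<in>UNIV. cmod (1 - d i) powr p)"
  using assms unitaries_one by (intro schatten_dist_spec_mat) simp_all

lemma refl_at_spec_mat: "Q \<in> unitaries \<Longrightarrow> refl_at (spec_mat Q e) (spec_mat Q d) = spec_mat Q (\<lambda>i. e i * cnj (d i) * e i)"
  by (simp add: refl_at_def spec_mat_adj spec_mat_mult)

lemma continuous_rot_right: "continuous_on UNIV (rot x)"
  unfolding rot_def map_matrix_def by (intro continuous_intros continuous_on_vec_lambda)

lemma continuous_rot_left: "continuous_on UNIV (\<lambda>x. rot x z)"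
  unfolding rot_def map_matrix_def proj_def
  by (simp, intro continuous_intros continuous_on_vec_lambda)

lemma mat_adj_rot: "mat_adj (rot x z) = rot x (cnj z)"
  by (simp add: vec_eq_iff rot_def proj_def mat_def mult_ac)

lemma norm_one_minus_cis_le: "cmod (1 - cis t) \<le> \<bar>t\<bar>"
  unfolding norm_one_minus_cis using abs_sin_x_le_abs_x[of "t / 2"] by linarith

lemma unit_circle_cis:
  assumes "cmod z = 1"
  obtains t where "0 \<le> t" "t < 2 * pi" "z = cis t"
  using assms Arg2pi_ge_0[of z] Arg2pi_lt_2pi[of z] complex_eq_iff[of z]
  by (metis Arg2pi_eq cis_conv_exp mult_1 norm_zero of_real_1 zero_neq_one)

text \<open>Rounding the angle down to a multiple of the step costs at most one step. The orders run
  through the multiples of a fixed \<open>M\<close>, so that they keep the divisors of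
  \<open>M\<close>.\<close>

lemma rational_angles_dense:
  assumes "0 \<le> t" "0 < M"
  shows "(\<lambda>j. cis (2 * pi / (real M * real (Suc j))) ^ nat \<lfloor>t * (real M * real (Suc j)) / (2 * pi)\<rfloor>) \<longlonglongrightarrow> cis t"
proof -
  define m where "m j = real M * real (Suc j)" for j
  have m: "0 < m j" for j using assms by (simp add: m_def)
  define n where "n j = nat \<lfloor>t * m j / (2 * pi)\<rfloor>" for j
  have lim: "(\<lambda>j. 2 * pi / m j) \<longlonglongrightarrow> 0"
  proof -
    have "(\<lambda>j. 2 * pi / real M * inverse (real (Suc j))) \<longlonglongrightarrow> 2 * pi / real M * 0"
      by (intro tendsto_intros LIMSEQ_inverse_real_of_nat)
    thus ?thesis by (simp add: m_def field_simps)
  qed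
  have bounds: "t - 2 * pi / m j \<le> real (n j) * (2 * pi / m j)" "real (n j) * (2 * pi / m j) \<le> t" for j
  proof -
    define r where "r = t * m j / (2 * pi)"
    have r: "0 \<le> r" using m[of j] assms by (simp add: r_def)
    hence "real (n j) \<le> r" "r - 1 \<le> real (n j)"
      by (simp_all add: n_def r_def[symmetric] of_nat_nat)
    hence "real (n j) * (2 * pi / m j) \<le> r * (2 * pi / m j)" "(r - 1) * (2 * pi / m j) \<le> real (n j) * (2 * pi / m j)"
      using m[of j] by (intro mult_right_mono; simp)+
    moreover have "r * (2 * pi / m j) = t"
      using m[of j] by (simp add: r_def)
    ultimately show "t - 2 * pi / m j \<le> real (n j) * (2 * pi / m j)" "real (n j) * (2 * pi / m j) \<le> t"
      by (simp_all add: left_diff_distrib diff_divide_distrib)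
  qed
  have "(\<lambda>j. real (n j) * (2 * pi / m j)) \<longlonglongrightarrow> t"
  proof (rule tendsto_sandwich[where h = "\<lambda>_. t"])
    show "(\<lambda>j. t - 2 * pi / m j) \<longlonglongrightarrow> t"
      using tendsto_diff[OF tendsto_const lim, of t] by simp
  qed (simp_all only: bounds always_eventually tendsto_const simp_thms)
  hence "(\<lambda>j. cis (real (n j) * (2 * pi / m j))) \<longlonglongrightarrow> cis t"
    by (intro tendsto_intros)
  thus ?thesis by (simp add: Complex.DeMoivre n_def m_def)
qed

locale normalized_isometry = unitary_isometry p \<psi> for p and \<psi> :: "complex^'n^'n \<Rightarrow> complex^'n^'n" +
  fixes \<delta> :: real
  assumes one: "\<psi> (mat 1) = mat 1"
    and \<delta>: "0 < \<delta>"
    and reflection: "\<And>a b. a \<in> unitaries \<Longrightarrow> b \<in> unitaries \<Longrightarrow> schatten_dist p a b < \<delta> \<Longrightarrow>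
      \<psi> (refl_at b a) = refl_at (\<psi> b) (\<psi> a)"
begin

text \<open>Reflecting a power at its successor gives the next power, so the induction carries two
  consecutive ones. By left invariance consecutive powers are as close as the identity and the
  matrix itself; smallness of that one distance admits every step.\<close>

lemma powers:
  assumes Q: "Q \<in> unitaries" and R: "R \<in> unitaries"
    and d: "\<And>i. cmod (d i) = 1" and e: "\<And>i. cmod (e i) = 1"
    and small: "schatten_dist p (mat 1) (spec_mat Q d) < \<delta>" and eq: "\<psi> (spec_mat Q d) = spec_mat R e"
  shows "\<psi> (spec_mat Q (\<lambda>i. d i ^ m)) = spec_mat R (\<lambda>i. e i ^ m)"
proof -
  have "\<psi> (spec_mat Q (\<lambda>i. d i ^ m)) = spec_mat R (\<lambda>i. e i ^ m) \<and> \<psi> (spec_mat Q (\<lambda>i. d i ^ Suc m)) = spec_mat R (\<lambda>i. e i ^ Suc m)"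
  proof (induction m)
    case 0
    show ?case using eq one Q R by (simp add: spec_mat_one)
  next
    case (Suc m)
    have un: "c ^ Suc m * cnj (c ^ m) * c ^ Suc m = c ^ Suc (Suc m)" if "cmod c = 1" for c
    proof -
      have "c ^ m * cnj (c ^ m) = 1"
        using complex_norm_square[of "c ^ m"] that by (simp add: norm_power)
      moreover have "c ^ Suc m * cnj (c ^ m) * c ^ Suc m = c ^ Suc (Suc m) * (c ^ m * cnj (c ^ m))"
        by (simp add: mult_ac)
      ultimately show ?thesis by simp
    qed
    let ?a = "spec_mat Q (\<lambda>i. d i ^ m)" and ?b = "spec_mat Q (\<lambda>i. d i ^ Suc m)"
    have a: "?a \<in> unitaries" and b: "?b \<in> unitaries"
      using Q d by (auto intro!: spec_mat_in_unitaries simp: norm_mult norm_power)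
    have "?b = ?a ** spec_mat Q d" by (simp add: spec_mat_mult Q mult.commute)
    hence "schatten_dist p ?a ?b = schatten_dist p (mat 1) (spec_mat Q d)"
      using schatten_dist_mult_left[OF a, of p "mat 1" "spec_mat Q d"] by simp
    hence "\<psi> (refl_at ?b ?a) = refl_at (\<psi> ?b) (\<psi> ?a)"
      using reflection[OF a b] small by simp
    thus ?case using Suc by (simp only: refl_at_spec_mat[OF Q] refl_at_spec_mat[OF R] un[OF d] un[OF e])
  qed
  thus ?thesis by blast
qed

text \<open>The eigenvalues of \<open>\<psi> (rot x \<omega>)\<close> are again \<open>m\<close>-th roots of unity, and those other than 1 lie at
  distance at least \<open>\<bar>1 - \<omega>\<bar>\<close> from 1; since \<open>\<psi>\<close> preserves the distance to the identity, only one of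
  them differs from 1.\<close>

lemma root_of_unity_rule:
  fixes x :: "complex^'n"
  assumes x: "norm x = 1" and m: "1 < m" and \<omega>: "\<omega> = cis (2 * pi / real m)"
    and small: "cmod (1 - \<omega>) powr p < \<delta>"
  obtains y s where "norm y = 1" "\<And>n. \<psi> (rot x (\<omega> ^ n)) = rot y (cnj_if s (\<omega> ^ n))"
proof -
  obtain Q k where Q: "Q \<in> unitaries" "\<And>z. rot x z = spec_mat Q ((\<lambda>_. 1)(k := z))"
    using rot_spec_mat[OF x] by metis
  let ?d = "(\<lambda>_. 1)(k := \<omega>)"
  have \<omega>1: "cmod \<omega> = 1" by (simp add: \<omega>)
  have \<omega>n1: "\<omega> \<noteq> 1"
  proof
    assume "\<omega> = 1"
    hence "Re (1 - cis (2 * pi / real m)) = 0" "sin (pi / real m) = 0"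
      using norm_one_minus_cis[of "2 * pi / real m"] by (simp_all add: \<omega>)
    moreover have "sin (pi / real m) > 0"
      using m by (intro sin_gt_zero) (auto simp: field_simps)
    ultimately show False by simp
  qed
  have "real m * (2 * pi / real m) = 2 * pi" using m by simp
  hence \<omega>m: "\<omega> ^ m = 1" unfolding \<omega> Complex.DeMoivre by (simp only: cis_2pi)
  have V: "spec_mat Q ?d \<in> unitaries" using Q \<omega>1 by (intro spec_mat_in_unitaries) auto
  obtain R e where R: "R \<in> unitaries" "\<psi> (spec_mat Q ?d) = spec_mat R e" "\<And>i. cmod (e i) = 1"
    using unitary_spectral[OF image_in[OF V]] by metis
  have dlV: "schatten_dist p (mat 1) (spec_mat Q ?d) = cmod (1 - \<omega>) powr p"
    using schatten_dist_one_rot[OF p x, of \<omega>] Q by simp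
  have upd: "(\<lambda>i. ((\<lambda>_. 1)(j := z)) i ^ n) = (\<lambda>_. 1)(j := z ^ n)" for j n and z :: complex
    by auto
  have pow: "\<psi> (rot x (\<omega> ^ n)) = spec_mat R (\<lambda>i. e i ^ n)" for n
    using powers[OF Q(1) R(1) _ R(3) _ R(2), of n] \<omega>1 dlV small
    unfolding upd Q(2) by simp
  from pow[of m] have "spec_mat R (\<lambda>i. e i ^ m) = spec_mat R (\<lambda>_. 1)"
    by (simp add: \<omega>m one spec_mat_one R)
  hence em: "e i ^ m = 1" for i
    using spec_mat_inj[OF R(1)] by metis
  have far: "cmod (1 - \<omega>) powr p \<le> cmod (1 - e i) powr p" if "e i \<noteq> 1" for i
    using root_of_unity_distance[OF em that] m p unfolding \<omega> by (intro powr_mono2) auto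
  have "schatten_dist p (mat 1) (spec_mat R e) = schatten_dist p (mat 1) (spec_mat Q ?d)"
    using iso[OF unitaries_one V] one R by simp
  hence sum: "(\<Sum>i\<in>UNIV. cmod (1 - e i) powr p) = cmod (1 - \<omega>) powr p"
    unfolding dlV schatten_dist_one_spec_mat[OF p R(1)] .
  have pos: "cmod (1 - \<omega>) powr p > 0" using \<omega>n1 by simp
  obtain j where j: "e j \<noteq> 1"
  proof (rule ccontr)
    assume "\<not> thesis"
    hence "\<And>i. e i = 1" using that by blast
    thus False using sum pos by simp
  qed
  have split: "cmod (1 - \<omega>) powr p = cmod (1 - e j) powr p + (\<Sum>i\<in>UNIV - {j}. cmod (1 - e i) powr p)"
    unfolding sum[symmetric] by (rule sum.remove) auto
  have rest: "(\<Sum>i\<in>UNIV - {j}. cmod (1 - e i) powr p) \<ge> 0" by (intro sum_nonneg) simp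
  have ej: "cmod (1 - e j) powr p = cmod (1 - \<omega>) powr p"
    using split rest far[OF j] by linarith
  hence "(\<Sum>i\<in>UNIV - {j}. cmod (1 - e i) powr p) = 0" using split by linarith
  hence "\<forall>i\<in>UNIV - {j}. cmod (1 - e i) powr p = 0"
    by (subst (asm) sum_nonneg_eq_0_iff) auto
  hence e1: "e = (\<lambda>_. 1)(j := e j)" by auto
  have "cmod (1 - e j) = cmod (1 - \<omega>)"
    using ej p powr_less_mono2[of p "cmod (1 - e j)" "cmod (1 - \<omega>)"]
      powr_less_mono2[of p "cmod (1 - \<omega>)" "cmod (1 - e j)"]
    by (metis less_irrefl linorder_less_linear norm_ge_zero)
  hence "e j = \<omega> \<or> e j = cnj \<omega>"
    using unit_eq_or_cnj[OF R(3) \<omega>1] by blast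
  then obtain s where s: "e j = cnj_if s \<omega>"
    by (metis cnj_if_def)
  show ?thesis
  proof (rule that[of "column j R" s])
    show "norm (column j R) = 1" using R by (simp add: norm_column_unitary)
    show "\<psi> (rot x (\<omega> ^ n)) = rot (column j R) (cnj_if s (\<omega> ^ n))" for n
      unfolding pow rot_column[OF R(1)] by (subst e1, unfold upd s) simp
  qed
qed

lemma rotation_rule:
  fixes x :: "complex^'n"
  assumes x: "norm x = 1"
  obtains y s where "norm y = 1" "\<And>z. cmod z = 1 \<Longrightarrow> \<psi> (rot x z) = rot y (cnj_if s z)"
proof -
  define \<epsilon> where "\<epsilon> = \<delta> powr (1 / p)"
  have \<epsilon>: "0 < \<epsilon>" "\<epsilon> powr p = \<delta>" using \<delta> p by (simp_all add: \<epsilon>_def powr_powr)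
  obtain N where N: "2 * pi / \<epsilon> < real N" using reals_Archimedean2 by blast
  \<comment> \<open>\<open>N\<close> makes the roots close enough to 1 for
    \<open>root_of_unity_rule\<close>; the factor 4 puts -1 and \<open>\<i>\<close> among the powers
    of every \<open>\<omega> j\<close>.\<close>
  define M where "M = 4 * Suc N"
  define \<omega> where "\<omega> j = cis (2 * pi / (real M * real (Suc j)))" for j
  have "\<exists>y s. norm y = 1 \<and> (\<forall>n. \<psi> (rot x (\<omega> j ^ n)) = rot y (cnj_if s (\<omega> j ^ n)))" for j
  proof -
    have MN: "real N < real M * real (Suc j)"
    proof -
      have "N < M * Suc j" by (simp add: M_def)
      thus ?thesis by (metis of_nat_less_iff of_nat_mult)
    qed
    hence pos: "0 < real M * real (Suc j)" by (meson of_nat_0_le_iff order_le_less_trans)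
    have "2 * pi < real M * real (Suc j) * \<epsilon>"
      using N MN \<epsilon> by (simp add: divide_less_eq) (smt (verit) mult_strict_right_mono)
    hence "2 * pi / (real M * real (Suc j)) < \<epsilon>"
      using pos by (simp add: divide_less_eq mult.commute)
    hence "cmod (1 - \<omega> j) < \<epsilon>"
      using norm_one_minus_cis_le[of "2 * pi / (real M * real (Suc j))"] pos by (simp add: \<omega>_def)
    hence "cmod (1 - \<omega> j) powr p < \<epsilon> powr p" using p by (intro powr_less_mono2) auto
    hence small: "cmod (1 - \<omega> j) powr p < \<delta>" by (simp add: \<epsilon>)
    have \<omega>': "\<omega> j = cis (2 * pi / real (M * Suc j))" by (simp only: \<omega>_def of_nat_mult)
    have "1 < M * Suc j" by (simp add: M_def)
    from root_of_unity_rule[OF x this \<omega>' small] show ?thesis by metis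
  qed
  then obtain Y S where Y: "\<And>j. norm (Y j) = 1"
    and YS: "\<And>j n. \<psi> (rot x (\<omega> j ^ n)) = rot (Y j) (cnj_if (S j) (\<omega> j ^ n))"
    by metis
  have half: "\<omega> j ^ (2 * Suc N * Suc j) = -1" and quarter: "\<omega> j ^ (Suc N * Suc j) = \<i>" for j
  proof -
    have "real (2 * Suc N * Suc j) * (2 * pi / (real M * real (Suc j))) = pi"
      unfolding M_def of_nat_mult by (simp del: of_nat_Suc)
    thus "\<omega> j ^ (2 * Suc N * Suc j) = -1"
      unfolding \<omega>_def Complex.DeMoivre by (simp only: cis_pi)
    have "real (Suc N * Suc j) * (2 * pi / (real M * real (Suc j))) = pi / 2"
      unfolding M_def of_nat_mult by (simp del: of_nat_Suc)
    thus "\<omega> j ^ (Suc N * Suc j) = \<i>"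
      unfolding \<omega>_def Complex.DeMoivre by (simp only: cis_pi_half)
  qed
  have minus: "cnj_if b (-1) = -1" for b by (simp add: cnj_if_def)
  have neq: "(-1::complex) \<noteq> 1" by simp
  \<comment> \<open>At -1 conjugation is invisible, so the lines can be compared before the choices
    \<open>S j\<close> are known to agree.\<close>
  have Yj: "proj (Y j) = proj (Y 0)" for j
    using YS[of j "2 * Suc N * Suc j"] YS[of 0 "2 * Suc N * Suc 0"] 
    unfolding half minus using proj_eq_iff_rot[OF neq] by metis
  \<comment> \<open>At \<open>\<i>\<close> the two choices give different rotations about the common
    line.\<close>
  have Sj: "S j = S 0" for j
  proof -
    have "rot (Y j) (cnj_if (S j) \<i>) = rot (Y j) (cnj_if (S 0) \<i>)"
      using YS[of j "Suc N * Suc j"] YS[of 0 "Suc N * Suc 0"] rot_cong[OF Yj]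
      unfolding quarter by metis
    from rot_inj[OF Y this] show ?thesis
      by (auto simp: cnj_if_def complex_eq_iff split: if_splits)
  qed
  have rule0: "\<psi> (rot x (\<omega> j ^ n)) = rot (Y 0) (cnj_if (S 0) (\<omega> j ^ n))" for j n
    using YS[of j n] unfolding Sj[of j] rot_cong[OF Yj[of j]] .
  show ?thesis
  proof (rule that[OF Y[of 0], of "S 0"])
    fix z :: complex assume z: "cmod z = 1"
    obtain t where t: "0 \<le> t" "z = cis t" using unit_circle_cis[OF z] by metis
    define a where "a j = \<omega> j ^ nat \<lfloor>t * (real M * real (Suc j)) / (2 * pi)\<rfloor>" for j
    have a: "a \<longlonglongrightarrow> z"
      using rational_angles_dense[OF t(1), of M] by (simp add: a_def[abs_def] \<omega>_def M_def t(2))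
    have ca: "cmod (a j) = 1" for j by (simp add: a_def \<omega>_def norm_power)
    have cc: "continuous_on UNIV (cnj_if b)" for b
      unfolding cnj_if_def[abs_def] by (cases b) (auto intro!: continuous_intros)
    have "(\<lambda>j. rot x (a j)) \<longlonglongrightarrow> rot x z"
      by (rule continuous_on_tendsto_compose[OF continuous_rot_right a]) auto
    hence "(\<lambda>j. \<psi> (rot x (a j))) \<longlonglongrightarrow> \<psi> (rot x z)"
      by (rule continuous_on_tendsto_compose[OF continuous])
        (auto intro!: always_eventually rot_in_unitaries x z ca)
    moreover have "(\<lambda>j. cnj_if (S 0) (a j)) \<longlonglongrightarrow> cnj_if (S 0) z"
      by (rule continuous_on_tendsto_compose[OF cc a]) auto
    hence "(\<lambda>j. rot (Y 0) (cnj_if (S 0) (a j))) \<longlonglongrightarrow> rot (Y 0) (cnj_if (S 0) z)"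
      by (rule continuous_on_tendsto_compose[OF continuous_rot_right]) auto
    hence "(\<lambda>j. \<psi> (rot x (a j))) \<longlonglongrightarrow> rot (Y 0) (cnj_if (S 0) z)"
      by (simp add: a_def rule0)
    ultimately show "\<psi> (rot x z) = rot (Y 0) (cnj_if (S 0) z)"
      by (rule LIMSEQ_unique)
  qed
qed

lemma uniform_rotation_rule:
  obtains g :: "complex^'n \<Rightarrow> complex^'n" and s
  where "\<And>x. norm x = 1 \<Longrightarrow> norm (g x) = 1"
    "\<And>x z. norm x = 1 \<Longrightarrow> cmod z = 1 \<Longrightarrow> \<psi> (rot x z) = rot (g x) (cnj_if s z)"
proof -
  have "\<exists>y s. norm x = 1 \<longrightarrow> norm y = 1 \<and> (\<forall>z. cmod z = 1 \<longrightarrow> \<psi> (rot x z) = rot y (cnj_if s z))" for x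
    using rotation_rule by metis
  then obtain g S where g: "\<And>x. norm x = 1 \<Longrightarrow> norm (g x) = 1"
    and gS: "\<And>x z. norm x = 1 \<Longrightarrow> cmod z = 1 \<Longrightarrow> \<psi> (rot x z) = rot (g x) (cnj_if (S x) z)"
    by metis
  \<comment> \<open>The trace reads the choice off as the sign of an imaginary part and does not see
    \<open>g\<close>, which was chosen pointwise and may be discontinuous.\<close>
  define f where "f x = Im (trace (\<psi> (rot x \<i>)))" for x
  have f: "f x = (if S x then -1 else 1)" if "norm x = 1" for x
    using that by (simp add: f_def gS trace_rot g cnj_if_def)
  have "continuous_on (sphere 0 1) (\<lambda>x. \<psi> (rot x \<i>))"
    by (rule continuous_on_compose2[OF continuous continuous_on_subset[OF continuous_rot_left]])
      (auto simp: rot_in_unitaries)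
  hence "continuous_on (sphere 0 1) f"
    unfolding f_def trace_def by (intro continuous_intros)
  \<comment> \<open>The real dimension is twice \<open>CARD('n)\<close>, hence at least 2 even for
    one-by-one matrices.\<close>
  moreover have "connected (sphere (0 :: complex^'n) 1)"
    by (simp add: connected_sphere_eq)
  ultimately have conn: "connected (f ` sphere 0 1)"
    by (rule connected_continuous_image)
  have "S x = S y" if "norm x = 1" "norm y = 1" for x y
  proof (rule ccontr)
    assume "S x \<noteq> S y"
    hence "-1 \<in> f ` sphere 0 1" "1 \<in> f ` sphere 0 1"
      using f[OF that(1)] f[OF that(2)] that by (auto split: if_splits intro: rev_image_eqI)
    from connectedD_interval[OF conn this, of 0] obtain u where "norm u = 1" "f u = 0" by auto
    thus False using f[of u] by (simp split: if_splits)
  qed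
  then obtain s where "\<And>x. norm x = 1 \<Longrightarrow> S x = s" by metis
  with gS have "\<psi> (rot x z) = rot (g x) (cnj_if s z)" if "norm x = 1" "cmod z = 1" for x z
    using that by simp
  with g show ?thesis by (rule that)
qed

text \<open>A unitary near the identity is built up from its rotations about eigenlines by reflections; an
  arbitrary one is a power of such a unitary.\<close>

lemma eq_if_eq_on_rotations:
  assumes \<theta>: "\<And>Q. Q \<in> unitaries \<Longrightarrow> \<exists>R\<in>unitaries. \<forall>d. \<theta> (spec_mat Q d) = spec_mat R (\<lambda>i. cnj_if s (d i))"
    and agree: "\<And>x z. norm x = 1 \<Longrightarrow> cmod z = 1 \<Longrightarrow> \<psi> (rot x z) = \<theta> (rot x z)"
    and U: "U \<in> unitaries"
  shows "\<psi> U = \<theta> U"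
proof -
  obtain Q d where Q: "Q \<in> unitaries" "U = spec_mat Q d" "\<And>i. cmod (d i) = 1"
    using unitary_spectral[OF U] by metis
  obtain R where R: "R \<in> unitaries" "\<And>d. \<theta> (spec_mat Q d) = spec_mat R (\<lambda>i. cnj_if s (d i))"
    using \<theta>[OF Q(1)] by blast
  have near: "\<psi> (spec_mat Q (\<lambda>i. if i \<in> I then d i else 1)) = \<theta> (spec_mat Q (\<lambda>i. if i \<in> I then d i else 1))"
    if "\<And>i. cmod (d i) = 1" "(\<Sum>i\<in>UNIV. cmod (1 - d i) powr p) < \<delta>" for I d
    using finite[of I] that
  proof (induction I arbitrary: d)
    case empty
    show ?case using R(2)[of "\<lambda>_. 1"] by (simp add: spec_mat_one Q R(1) one)
  next
    case (insert j I)
    have cnj_dist: "cmod (1 - cnj z) = cmod (1 - z)" for z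
      by (metis complex_cnj_diff complex_cnj_one complex_mod_cnj)
    \<comment> \<open>Reflection conjugates the reflected point, so the induction hypothesis is
      applied to the conjugate of \<open>d\<close> on \<open>I\<close>; at \<open>j\<close>, where
      \<open>u\<close> is 1, the root in \<open>v\<close> gets squared.\<close>
    define u where "u = (\<lambda>i. if i \<in> I then cnj (d i) else 1)"
    define v where "v = (\<lambda>_. 1)(j := csqrt (d j))"
    let ?a = "spec_mat Q u" and ?b = "spec_mat Q v"
    have a: "?a \<in> unitaries" and b: "?b \<in> unitaries"
      using Q insert.prems by (auto intro!: spec_mat_in_unitaries simp: u_def v_def)
    have \<psi>a: "\<psi> ?a = \<theta> ?a"
      unfolding u_def by (rule insert.IH) (use insert.prems in \<open>simp_all add: cnj_dist\<close>)
    have bj: "?b = rot (column j Q) (csqrt (d j))"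
      unfolding v_def rot_column[OF Q(1)] ..
    have \<psi>b: "\<psi> ?b = \<theta> ?b"
      unfolding bj using insert.prems Q by (intro agree) (simp_all add: norm_column_unitary)
    have prod: "v i * cnj (u i) * v i = (if i \<in> insert j I then d i else 1)" for i
      using insert.hyps by (auto simp: u_def v_def simp flip: power2_eq_square)
    have "mat_adj ?a ** ?b = spec_mat Q (\<lambda>i. cnj (u i) * v i)"
      by (simp add: spec_mat_adj spec_mat_mult Q)
    hence "schatten_dist p ?a ?b = (\<Sum>i\<in>UNIV. cmod (1 - cnj (u i) * v i) powr p)"
      by (rule schatten_dist_spec_mat[OF p a Q(1)])
    \<comment> \<open>The quotient has eigenvalue \<open>d i\<close> on \<open>I\<close>, the square
      root of \<open>d j\<close> at \<open>j\<close> and 1 elsewhere, so the sum is bounded term by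
      term.\<close>
    also have "\<dots> \<le> (\<Sum>i\<in>UNIV. cmod (1 - d i) powr p)"
      using insert.hyps p cmod_one_minus_csqrt
      by (intro sum_mono powr_mono2) (auto simp: u_def v_def)
    finally have "\<psi> (refl_at ?b ?a) = refl_at (\<psi> ?b) (\<psi> ?a)"
      using insert.prems reflection[OF a b] by simp
    hence "\<psi> (spec_mat Q (\<lambda>i. v i * cnj (u i) * v i)) = \<theta> (spec_mat Q (\<lambda>i. v i * cnj (u i) * v i))"
      unfolding \<psi>a \<psi>b R refl_at_spec_mat[OF Q(1)] refl_at_spec_mat[OF R(1)] by simp
    thus ?case unfolding prod .
  qed
  have "\<forall>i. \<exists>t. 0 \<le> t \<and> t < 2 * pi \<and> d i = cis t"
    using unit_circle_cis[OF Q(3)] by metis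
  then obtain t where t: "\<And>i. 0 \<le> t i" "\<And>i. t i < 2 * pi" "\<And>i. d i = cis (t i)"
    by metis
  define n where "n = real CARD('n)"
  have n: "0 < n" by (simp add: n_def)
  \<comment> \<open>Each of the \<open>n\<close> eigenvalues is allotted
    \<open>\<delta> / n\<close>; dividing all angles by \<open>N\<close> brings the eigenvalues
    within \<open>\<epsilon>\<close> of 1.\<close>
  define \<epsilon> where "\<epsilon> = (\<delta> / n) powr (1 / p)"
  have \<epsilon>: "0 < \<epsilon>" "\<epsilon> powr p = \<delta> / n" using \<delta> p n by (simp_all add: \<epsilon>_def powr_powr)
  obtain N where N: "2 * pi / \<epsilon> < real N" using reals_Archimedean2 by blast
  have "0 < 2 * pi / \<epsilon>" using \<epsilon> by simp
  hence N0: "0 < real N" using N by linarith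
  define e where "e i = cis (t i / real N)" for i
  have e1: "cmod (e i) = 1" for i by (simp add: e_def)
  have eN: "e i ^ N = d i" for i using N0 by (simp add: e_def Complex.DeMoivre t)
  have "cmod (1 - e i) < \<epsilon>" for i
  proof -
    have "cmod (1 - e i) \<le> t i / real N"
      using norm_one_minus_cis_le[of "t i / real N"] t(1)[of i] N0 by (simp add: e_def)
    also have "\<dots> < 2 * pi / real N" using t(2)[of i] N0 by (simp add: divide_strict_right_mono)
    also have "\<dots> < \<epsilon>" using N \<epsilon>(1) N0 by (simp add: divide_less_eq mult.commute)
    finally show ?thesis .
  qed
  hence "cmod (1 - e i) powr p < \<delta> / n" for i
    unfolding \<epsilon>(2)[symmetric] using p by (intro powr_less_mono2) auto
  hence "(\<Sum>i\<in>UNIV. cmod (1 - e i) powr p) < (\<Sum>i::'n\<in>UNIV. \<delta> / n)"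
    by (intro sum_strict_mono) auto
  hence small: "(\<Sum>i\<in>UNIV. cmod (1 - e i) powr p) < \<delta>"
    using n by (simp add: n_def)
  have "\<psi> (spec_mat Q e) = spec_mat R (\<lambda>i. cnj_if s (e i))"
    using near[of e UNIV] e1 small by (simp add: R)
  from powers[OF Q(1) R(1) e1 _ _ this, of N]
  have "\<psi> (spec_mat Q d) = spec_mat R (\<lambda>i. cnj_if s (e i) ^ N)"
    using small e1 by (simp add: schatten_dist_one_spec_mat[OF p Q(1)] eN)
  also have "\<dots> = \<theta> (spec_mat Q d)"
    by (simp add: R eN flip: cnj_if_simps)
  finally show ?thesis by (simp add: Q)
qed

end

subsection \<open>Classification\<close>

lemma star_automorphism_conjugation:
  assumes V: "V \<in> unitaries"
  shows "star_automorphism (\<lambda>A. V ** A ** mat_adj V)"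
proof -
  have "bij (\<lambda>A. V ** A ** mat_adj V)"
    by (rule bij_betw_byWitness[where f' = "\<lambda>A. mat_adj V ** A ** V"])
      (auto simp: matrix_mul_assoc unitary_cancel[OF V] unitariesD[OF V])
  moreover have "V ** map_matrix ((*) c) A ** mat_adj V = map_matrix ((*) c) (V ** A ** mat_adj V)" for c A
    by (simp add: vec_eq_iff matrix_matrix_mult_def sum_distrib_left sum_distrib_right mult_ac)
  moreover have "V ** (A ** B) ** mat_adj V = V ** A ** mat_adj V ** (V ** B ** mat_adj V)" for A B
    by (simp add: matrix_mul_assoc unitary_cancel[OF V])
  ultimately show ?thesis
    by (simp add: star_automorphism_def complex_linear_def mat_adj_mult matrix_mul_assoc
        matrix_add_ldistrib matrix_add_rdistrib)
qed

lemma star_anti_automorphism_transpose_conjugation: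
  fixes V :: "complex^'n^'n"
  assumes V: "V \<in> unitaries"
  shows "star_anti_automorphism (\<lambda>A. V ** transpose A ** mat_adj V)"
proof -
  have t: "bij (transpose :: complex^'n^'n \<Rightarrow> _)"
    by (rule bij_betw_byWitness[where f' = transpose]) (auto simp: transpose_transpose)
  have "transpose (A + B) = transpose A + transpose B" "transpose (map_matrix ((*) c) A) = map_matrix ((*) c) (transpose A)"
    "transpose (mat_adj A) = mat_adj (transpose A)" "transpose (A ** B) = transpose B ** transpose A"
    for A B :: "complex^'n^'n" and c
    by (simp_all add: vec_eq_iff transpose_def matrix_matrix_mult_def mult.commute)
  moreover have "bij (\<lambda>A. V ** transpose A ** mat_adj V)"
    using bij_comp[OF t] star_automorphism_conjugation[OF V]
    by (auto simp: star_automorphism_def comp_def)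
  ultimately show ?thesis
    using star_automorphism_conjugation[OF V]
    by (simp add: star_automorphism_def star_anti_automorphism_def complex_linear_def)
qed

lemma transpose_spec_mat: "transpose (spec_mat Q d) = spec_mat (map_matrix cnj Q) d"
  by (simp add: vec_eq_iff transpose_def spec_mat_nth mult_ac)

lemma map_matrix_cnj_unitary:
  assumes "Q \<in> unitaries"
  shows "map_matrix cnj Q \<in> unitaries"
proof -
  have "map_matrix cnj Q = transpose (mat_adj Q)"
    by (simp add: vec_eq_iff transpose_def)
  moreover have "mat_adj (transpose (mat_adj Q)) ** transpose (mat_adj Q) = transpose (mat_adj Q ** Q)"
    by (simp add: vec_eq_iff transpose_def matrix_matrix_mult_def mult.commute)
  ultimately show ?thesis
    using assms by (simp add: unitaries_iff transpose_mat)
qed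

text \<open>Two independent choices remain: \<open>s\<close>, conjugation of eigenvalues, decides
  between \<open>U\<close> and its adjoint, and \<open>b\<close>, from Wigner's theorem, between
  conjugation by a unitary and its composition with transposition.\<close>

lemma (in normalized_isometry) classification:
  obtains \<phi> s where "star_automorphism \<phi> \<or> star_anti_automorphism \<phi>"
    "\<And>U. U \<in> unitaries \<Longrightarrow> \<psi> U = \<phi> (if s then mat_adj U else U)"
proof -
  obtain g s where g: "\<And>x. norm x = 1 \<Longrightarrow> norm (g x) = 1"
    and gs: "\<And>x z. norm x = 1 \<Longrightarrow> cmod z = 1 \<Longrightarrow> \<psi> (rot x z) = rot (g x) (cnj_if s z)"
    using uniform_rotation_rule by blast
  have cip_g: "cmod (cip (g x) (g y)) = cmod (cip x y)" if x: "norm x = 1" and y: "norm y = 1" for x y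
  proof (rule schatten_dist_symmetries_inj[OF p g[OF x] g[OF y] x y])
    \<comment> \<open>Symmetries have the real eigenvalue -1, so their distances transfer whatever
      \<open>s\<close> is.\<close>
    have "cnj_if s (-1) = -1" by (simp add: cnj_if_def)
    thus "schatten_dist p (rot (g x) (-1)) (rot (g y) (-1)) = schatten_dist p (rot x (-1)) (rot y (-1))"
      using iso[of "rot x (-1)" "rot y (-1)"] gs[of _ "-1"] x y by (simp add: rot_in_unitaries)
  qed
  obtain V b where V: "V \<in> unitaries"
    and Vb: "\<And>x. norm x = 1 \<Longrightarrow> proj (g x) = V ** map_matrix (cnj_if b) (proj x) ** mat_adj V"
    using wigner[OF g cip_g] by blast
  define \<phi> where "\<phi> A = V ** (if b then transpose A else A) ** mat_adj V" for A
  have \<phi>: "star_automorphism \<phi> \<or> star_anti_automorphism \<phi>"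
    unfolding \<phi>_def[abs_def]
    using star_automorphism_conjugation[OF V] star_anti_automorphism_transpose_conjugation[OF V]
    by (cases b) simp_all
  have \<phi>spec_mat: "\<exists>R\<in>unitaries. \<forall>d. \<phi> (spec_mat Q d) = spec_mat R d" if "Q \<in> unitaries" for Q
  proof (intro bexI allI)
    let ?Q = "if b then map_matrix cnj Q else Q"
    show "\<phi> (spec_mat Q d) = spec_mat (V ** ?Q) d" for d
      by (simp add: \<phi>_def transpose_spec_mat spec_mat_conjugate)
    show "V ** ?Q \<in> unitaries"
      using that V by (simp add: unitaries_mult map_matrix_cnj_unitary)
  qed
  have \<phi>rot: "\<phi> (rot x z) = rot (g x) z" if "norm x = 1" for x z
  proof -
    \<comment> \<open>A projection is Hermitian, so its transpose is its entrywise conjugate, while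
      the scalar \<open>z - 1\<close> stays unconjugated.\<close>
    have "(if b then transpose (rot x z) else rot x z) = mat 1 + map_matrix ((*) (z - 1)) (map_matrix (cnj_if b) (proj x))"
      by (simp add: vec_eq_iff rot_def transpose_def proj_def cnj_if_def mat_def mult_ac)
    moreover have "V ** (mat 1 + map_matrix ((*) c) A) ** mat_adj V = mat 1 + map_matrix ((*) c) (V ** A ** mat_adj V)" for c A
      using star_automorphism_conjugation[OF V]
      by (simp add: star_automorphism_def complex_linear_def unitariesD[OF V])
    ultimately show ?thesis
      unfolding \<phi>_def using Vb[OF that] by (simp add: rot_def)
  qed
  define \<theta> where "\<theta> U = \<phi> (if s then mat_adj U else U)" for U
  have "\<psi> U = \<theta> U" if "U \<in> unitaries" for U
  proof (rule eq_if_eq_on_rotations[OF _ _ that])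
    show "\<exists>R\<in>unitaries. \<forall>d. \<theta> (spec_mat Q d) = spec_mat R (\<lambda>i. cnj_if s (d i))" if "Q \<in> unitaries" for Q
      using \<phi>spec_mat[OF that] by (cases s) (auto simp: \<theta>_def spec_mat_adj cnj_if_def)
    show "\<psi> (rot x z) = \<theta> (rot x z)" if "norm x = 1" "cmod z = 1" for x z
      using gs[OF that] \<phi>rot[OF that(1)] by (cases s) (simp_all add: \<theta>_def mat_adj_rot cnj_if_def)
  qed
  thus ?thesis using that \<phi> unfolding \<theta>_def by blast
qed

text \<open>Left translation by the adjoint of \<open>\<psi> (mat 1)\<close> preserves distances, so
  the normalized map inherits the hypotheses; translating back supplies \<open>W\<close>.\<close>

theorem lemma2p1:
  fixes p :: real
    and \<psi> :: "complex^'n^'n \<Rightarrow> complex^'n^'n"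
  assumes "0 < p"
    and "Lp_isometry p \<psi>"
    and "\<psi> ` unitaries = unitaries"
  shows "\<exists>W\<in>unitaries. \<exists>\<phi> :: complex^'n^'n \<Rightarrow> complex^'n^'n.
           (star_automorphism \<phi> \<or> star_anti_automorphism \<phi>) \<and>
           ((\<forall>U\<in>unitaries. \<psi> U = W ** \<phi> U) \<or>
            (\<forall>U\<in>unitaries. \<psi> U = W ** \<phi> (mat_adj U)))"
proof -
  let ?W = "\<psi> (mat 1)"
  have W: "?W \<in> unitaries" using assms(3) unitaries_one by blast
  define \<eta> where "\<eta> U = mat_adj ?W ** \<psi> U" for U
  have \<psi>in: "\<psi> U \<in> unitaries" if "U \<in> unitaries" for U using that assms(3) by blast
  have iso: "schatten_dist p (\<psi> U) (\<psi> V) = schatten_dist p U V" if "U \<in> unitaries" "V \<in> unitaries" for U V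
    using that assms(2) by (simp add: schatten_dist_def schatten_def Lp_isometry_def)
  have "inj_on \<psi> unitaries"
  proof (rule inj_onI)
    fix U V :: "complex^'n^'n" assume UV: "U \<in> unitaries" "V \<in> unitaries" "\<psi> U = \<psi> V"
    have "schatten_dist p (\<psi> V) (\<psi> V) = 0"
      using schatten_dist_one_spec_mat[OF assms(1) unitaries_one, of "\<lambda>_. 1"] schatten_dist_mult_left[OF \<psi>in[OF UV(2)], of p "mat 1" "mat 1"]
      by (simp add: spec_mat_one unitaries_one)
    thus "U = V" using schatten_dist_eq_0[OF assms(1) UV(1,2)] iso[OF UV(1,2)] UV(3) by simp
  qed
  hence "bij_betw \<psi> unitaries unitaries" using assms(3) by (simp add: bij_betw_def)
  moreover have "bij_betw ((**) (mat_adj ?W)) unitaries unitaries"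
    by (rule bij_betw_byWitness[where f' = "(**) ?W"])
      (auto simp: unitary_cancel[OF W] intro: unitaries_mult unitaries_adj W)
  ultimately have "bij_betw ((**) (mat_adj ?W) \<circ> \<psi>) unitaries unitaries"
    by (rule bij_betw_trans)
  hence bij: "bij_betw \<eta> unitaries unitaries"
    by (simp add: \<eta>_def[abs_def] comp_def)
  interpret unitary_isometry p \<eta>
    by standard (use assms(1) bij iso W in \<open>simp_all add: \<eta>_def schatten_dist_mult_left unitaries_adj\<close>)
  obtain \<delta> where \<delta>: "0 < \<delta>" "\<And>a b. a \<in> unitaries \<Longrightarrow> b \<in> unitaries \<Longrightarrow> schatten_dist p a b < \<delta> \<Longrightarrow>
      \<eta> (refl_at b a) = refl_at (\<eta> b) (\<eta> a)"
    using reflection_preserved by blast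
  have "\<eta> (mat 1) = mat 1" by (simp add: \<eta>_def unitariesD[OF W])
  then interpret normalized_isometry p \<eta> \<delta>
    by unfold_locales (use \<delta> in simp_all)
  obtain \<phi> s where \<phi>: "star_automorphism \<phi> \<or> star_anti_automorphism \<phi>"
    "\<And>U. U \<in> unitaries \<Longrightarrow> \<eta> U = \<phi> (if s then mat_adj U else U)"
    using classification by blast
  have "\<psi> U = ?W ** \<phi> (if s then mat_adj U else U)" if "U \<in> unitaries" for U
    unfolding \<phi>(2)[OF that, symmetric] by (simp add: \<eta>_def unitary_cancel[OF W])
  with W \<phi>(1) show ?thesis by (cases s) auto
qed

end
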